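(* Let $M>2$, $N\neq0$, $\rho>0$, $k>\rho$ be integers with $\frac{k}{\rho M}<\frac12$, and let $$\nu=\frac14\Bigl(1-\cot^2\frac{\pi}{M}\,\tan^2\frac{k\pi}{\rho M}\Bigr)$$ (so that $\nu<0$); assume $\nu\neq-N^2$. Let $f_{m,n}=\mathbf{i}\,\frac nN+\mathbf{j}\,e^{\frac{2\pi\mathbf{i}}{M}m}$, $(m,n)\in\mathbb{Z}^2$, be the discrete circular cylinder with cross-ratios factorising function $\mu$ given by $\frac1{\mu_{(m,n),(m+1,n)}}=|1-e^{\frac{2\pi\mathbf{i}}{M}}|^2$ and $\frac1{\mu_{(m,n),(m,n+1)}}=-\frac1{N^2}$. Let $$c_2=\pm\frac{\sqrt{\cos\frac{2\pi}{M}-\cos\frac{2k\pi}{\rho M}}}{\sqrt2\,\sin\frac{(\rho-k)\pi}{\rho M}}$$ (either sign), and put $$A_m=e^{\frac{k\pi\mathbf{i}}{\rho M}m}+e^{-\frac{k\pi\mathbf{i}}{\rho M}m}c_2,\qquad B_m=e^{\frac{k\pi\mathbf{i}}{\rho M}m}\sin\tfrac{(\rho+k)\pi}{\rho M}+e^{-\frac{k\pi\mathbf{i}}{\rho M}m}\sin\tfrac{(\rho-k)\pi}{\rho M}\,c_2,$$ $$\begin{aligned} C_{m,n}&=2\bigl((N-\sqrt{-\nu})^n+(N+\sqrt{-\nu})^n\bigr)^2|B_m|^2\\&\quad+\bigl((N-\sqrt{-\nu})^n-(N+\sqrt{-\nu})^n\bigr)^2|A_m|^2\bigl(\cos\tfrac{2\pi}{M}-\cos\tfrac{2k\pi}{\rho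 M}\bigr),\\ T^0_{m,n}&=\frac{\mathbf{i}}{\sqrt{-\nu}}\bigl((N-\sqrt{-\nu})^{2n}-(N+\sqrt{-\nu})^{2n}\bigr)\bigl(2|B_m|^2+|A_m|^2(\cos\tfrac{2\pi}{M}-\cos\tfrac{2k\pi}{\rho M})\bigr),\\ T^1_{m,n}&=-16\,e^{\frac{2\pi\mathbf{i}}{M}m}(N-\sqrt{-\nu})^n(N+\sqrt{-\nu})^n\sin\tfrac{\pi}{M}\cos\tfrac{k\pi}{\rho M}\,A_m\overline{B_m}. \end{aligned}$$ Then $$\hat f_{m,n}=f_{m,n}+\frac1{C_{m,n}}\bigl(T^0_{m,n}+\mathbf{j}\,T^1_{m,n}\bigr)$$ is a Darboux transform of $f$ with spectral parameter $\nu$ taking values in $\mathbb{R}^3\cong\mathrm{Im}\,\mathbb{H}$, and it is a discrete constant mean curvature cylinder: $\hat f$ is a discrete cmc surface and $\hat f_{m+\rho M,n}=\hat f_{m,n}$ for all $(m,n)\in\mathbb{Z}^2$.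
   Context: $\mathbb{H}$ denotes the quaternions with basis $1,\mathbf{i},\mathbf{j},\mathbf{k}$; $\mathbb{C}=\mathrm{span}_{\mathbb{R}}\{1,\mathbf{i}\}$; $\mathbb{R}^3\cong\mathrm{Im}\,\mathbb{H}$. Vertices of an elementary quadrilateral: $i=(m,n)$, $j=(m+1,n)$, $k=(m+1,n+1)$, $\ell=(m,n+1)$. The cross-ratio is $\mathrm{cr}(a,b,c,d)=(a-b)(b-c)^{-1}(c-d)(d-a)^{-1}$. A discrete surface $f$ is discrete isothermic with cross-ratios factorising function $\mu$ (a nowhere-zero real function on unoriented edges with $\mu_{ij}=\mu_{k\ell}$, $\mu_{i\ell}=\mu_{jk}$) if $\mathrm{cr}(f_i,f_j,f_k,f_\ell)=\mu_{i\ell}/\mu_{ij}$ on every elementary quadrilateral; $\mu$ is determined up to a global real constant factor. A Darboux transform of $f$ with real spectral parameter $\nu$ is a discrete surface $\hat f$ with $\mathrm{cr}(f_i,f_j,\hat f_j,\hat f_i)=\nu/\mu_{ij}$ on every edge $(ij)$; it is discrete isothermic with the same $\mu$. A Christoffel transform of a discrete isothermic surface $f$ is a surface $f^*$ with $f^*_i-f^*_j=\frac1{\mu_{ij}}(f_i-f_j)^{-1}$ on every edge, for a cross-ratios factorising function $\mu$ of $f$ (so $f^*$ is defined up to translation and scaling). A discrete isothermic surface $f$ in $\mathbb{R}^3\cong\mathrm{Im}\,\mathbb{H}$ is a discrete cmc surface (with constant mean curvature $H\neq0$) if it admits a Christoffel transform $f^*$ in $\mathbb{R}^3$ with $|f^*_i-f_i|^2=\frac1{H^2}$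 at every vertex $i$. Here $\sqrt{-\nu}$ denotes the positive root. *)

theory Defs
  imports "HOL-Analysis.Analysis"
begin

section \<open>Quaternions\<close>

text \<open>A codatatype, as for \<^typ>\<open>complex\<close>, so that operations can be given componentwise
  by their selectors.\<close>

codatatype quat = Quat (QRe: real) (QI: real) (QJ: real) (QK: real)

lemma quat_eq_iff:
  "x = y \<longleftrightarrow> QRe x = QRe y \<and> QI x = QI y \<and> QJ x = QJ y \<and> QK x = QK y"
  by (auto intro: quat.expand)

instantiation quat :: ab_group_add
begin

primcorec zero_quat where
  "QRe 0 = 0" | "QI 0 = 0" | "QJ 0 = 0" | "QK 0 = 0"

primcorec plus_quat where
  "QRe (x + y) = QRe x + QRe y"
| "QI (x + y) = QI x + QI y"
| "QJ (x + y) = QJ x + QJ y"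
| "QK (x + y) = QK x + QK y"

primcorec uminus_quat where
  "QRe (- x) = - QRe x"
| "QI (- x) = - QI x"
| "QJ (- x) = - QJ x"
| "QK (- x) = - QK x"

primcorec minus_quat where
  "QRe (x - y) = QRe x - QRe y"
| "QI (x - y) = QI x - QI y"
| "QJ (x - y) = QJ x - QJ y"
| "QK (x - y) = QK x - QK y"

instance
  by standard (simp_all add: quat_eq_iff)

end

instantiation quat :: ring_1
begin

primcorec one_quat where
  "QRe 1 = 1" | "QI 1 = 0" | "QJ 1 = 0" | "QK 1 = 0"

primcorec times_quat where
  "QRe (x * y) = QRe x * QRe y - QI x * QI y - QJ x * QJ y - QK x * QK y"
| "QI (x * y) = QRe x * QI y + QI x * QRe y + QJ x * QK y - QK x * QJ y"
| "QJ (x * y) = QRe x * QJ y - QI x * QK y + QJ x * QRe y + QK x * QI y"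
| "QK (x * y) = QRe x * QK y + QI x * QJ y - QJ x * QI y + QK x * QRe y"

instance
  by standard (simp_all add: quat_eq_iff algebra_simps)

end

instantiation quat :: real_algebra_1
begin

primcorec scaleR_quat where
  "QRe (scaleR r x) = r * QRe x"
| "QI (scaleR r x) = r * QI x"
| "QJ (scaleR r x) = r * QJ x"
| "QK (scaleR r x) = r * QK x"

instance
  by standard (simp_all add: quat_eq_iff algebra_simps)

end

instantiation quat :: real_inner
begin

definition inner_quat :: "quat \<Rightarrow> quat \<Rightarrow> real" where
  "inner_quat x y = QRe x * QRe y + QI x * QI y + QJ x * QJ y + QK x * QK y"

definition norm_quat :: "quat \<Rightarrow> real" where
  "norm_quat x = sqrt (inner x x)"

definition sgn_quat :: "quat \<Rightarrow> quat" where
  "sgn_quat x = x /\<^sub>R norm x"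

definition dist_quat :: "quat \<Rightarrow> quat \<Rightarrow> real" where
  "dist_quat x y = norm (x - y)"

definition uniformity_quat :: "(quat \<times> quat) filter" where
  "uniformity_quat = (INF e\<in>{0<..}. principal {(x, y). dist x y < e})"

definition open_quat :: "quat set \<Rightarrow> bool" where
  "open_quat U \<longleftrightarrow> (\<forall>x\<in>U. eventually (\<lambda>(x', y). x' = x \<longrightarrow> y \<in> U) uniformity)"

instance
proof
  fix x y z :: quat and r :: real
  show "inner x y = inner y x"
    by (simp add: inner_quat_def mult.commute)
  show "inner (x + y) z = inner x z + inner y z"
    by (simp add: inner_quat_def algebra_simps)
  show "inner (scaleR r x) y = r * inner x y"
    by (simp add: inner_quat_def algebra_simps)
  show "0 \<le> inner x x"
    by (simp add: inner_quat_def)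
  show "inner x x = 0 \<longleftrightarrow> x = 0"
    by (simp add: inner_quat_def quat_eq_iff add_nonneg_eq_0_iff)
qed (rule norm_quat_def sgn_quat_def dist_quat_def uniformity_quat_def open_quat_def)+

end

primcorec qcnj :: "quat \<Rightarrow> quat" where
  "QRe (qcnj x) = QRe x"
| "QI (qcnj x) = - QI x"
| "QJ (qcnj x) = - QJ x"
| "QK (qcnj x) = - QK x"

lemma power2_norm_quat: "(norm (x :: quat))\<^sup>2 = inner x x"
  by (simp add: power2_norm_eq_inner)

lemma mult_qcnj: "x * qcnj x = inner x x *\<^sub>R 1" "qcnj x * x = inner x x *\<^sub>R 1"
  by (simp_all add: quat_eq_iff inner_quat_def algebra_simps)

instantiation quat :: real_normed_div_algebra
begin

definition inverse_quat :: "quat \<Rightarrow> quat" where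
  "inverse_quat x = qcnj x /\<^sub>R (norm x)\<^sup>2"

definition divide_quat :: "quat \<Rightarrow> quat \<Rightarrow> quat" where
  "divide_quat x y = x * inverse y"

instance
proof
  fix x y :: quat
  show "x \<noteq> 0 \<Longrightarrow> inverse x * x = 1" "x \<noteq> 0 \<Longrightarrow> x * inverse x = 1"
    by (simp_all add: inverse_quat_def mult_qcnj power2_norm_quat)
  show "inverse (0 :: quat) = 0"
    by (simp add: inverse_quat_def quat_eq_iff)
  have "inner (x * y) (x * y) = inner x x * inner y y"
    by (simp add: inner_quat_def algebra_simps)
  then show "norm (x * y) = norm x * norm y"
    by (simp add: norm_quat_def real_sqrt_mult)
qed (rule divide_quat_def)

end

definition quat_j :: quat where
  "quat_j = Quat 0 0 1 0"

definition quat_of_complex :: "complex \<Rightarrow> quat" where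
  "quat_of_complex z = Quat (Re z) (Im z) 0 0"

definition Im_quat :: "quat set" where
  "Im_quat = {q. QRe q = 0}"


section \<open>Discrete isothermic surfaces\<close>

type_synonym vertex = "int \<times> int"

definition adjacent :: "vertex \<Rightarrow> vertex \<Rightarrow> bool" where
  "adjacent p q \<longleftrightarrow> \<bar>fst p - fst q\<bar> + \<bar>snd p - snd q\<bar> = 1"

text \<open>A nowhere-zero real function on unoriented edges is a symmetric function of the two end
  points; its values at non-adjacent pairs are irrelevant.\<close>

definition edge_function :: "(vertex \<Rightarrow> vertex \<Rightarrow> real) \<Rightarrow> bool" where
  "edge_function \<mu> \<longleftrightarrow> (\<forall>p q. adjacent p q \<longrightarrow> \<mu> p q = \<mu> q p \<and> \<mu> p q \<noteq> 0)"

definition cross_ratio :: "quat \<Rightarrow> quat \<Rightarrow> quat \<Rightarrow> quat \<Rightarrow> quat" where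
  "cross_ratio a b c d = (a - b) * inverse (b - c) * (c - d) * inverse (d - a)"

text \<open>Since \<open>inverse 0 = 0\<close>, a nonzero value of \<^const>\<open>cross_ratio\<close> means that consecutive
  arguments are distinct; in particular the end points of every edge of a discrete isothermic
  surface are distinct.\<close>

definition discrete_isothermic :: "(vertex \<Rightarrow> vertex \<Rightarrow> real) \<Rightarrow> (vertex \<Rightarrow> quat) \<Rightarrow> bool" where
  "discrete_isothermic \<mu> f \<longleftrightarrow> edge_function \<mu> \<and>
    (\<forall>m n. let i = (m, n); j = (m + 1, n); k = (m + 1, n + 1); l = (m, n + 1) in
       \<mu> i j = \<mu> k l \<and> \<mu> i l = \<mu> j k \<and>
       cross_ratio (f i) (f j) (f k) (f l) = of_real (\<mu> i l / \<mu> i j))"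

text \<open>The condition \<open>g p \<noteq> f p\<close> makes the cross-ratios well defined also for \<open>\<nu> = 0\<close>; for
  \<open>\<nu> \<noteq> 0\<close> it follows from the equations.\<close>

definition darboux_transform ::
    "(vertex \<Rightarrow> vertex \<Rightarrow> real) \<Rightarrow> real \<Rightarrow> (vertex \<Rightarrow> quat) \<Rightarrow> (vertex \<Rightarrow> quat) \<Rightarrow> bool" where
  "darboux_transform \<mu> \<nu> f g \<longleftrightarrow> discrete_isothermic \<mu> f \<and> (\<forall>p. g p \<noteq> f p) \<and>
    (\<forall>p q. adjacent p q \<longrightarrow> cross_ratio (f p) (f q) (g q) (g p) = of_real (\<nu> / \<mu> p q))"

definition christoffel_transform ::
    "(vertex \<Rightarrow> vertex \<Rightarrow> real) \<Rightarrow> (vertex \<Rightarrow> quat) \<Rightarrow> (vertex \<Rightarrow> quat) \<Rightarrow> bool" where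
  "christoffel_transform \<mu> f g \<longleftrightarrow> discrete_isothermic \<mu> f \<and>
    (\<forall>p q. adjacent p q \<longrightarrow> g p - g q = (1 / \<mu> p q) *\<^sub>R inverse (f p - f q))"

definition discrete_cmc :: "real \<Rightarrow> (vertex \<Rightarrow> quat) \<Rightarrow> bool" where
  "discrete_cmc H f \<longleftrightarrow> H \<noteq> 0 \<and> range f \<subseteq> Im_quat \<and>
    (\<exists>\<mu> g. christoffel_transform \<mu> f g \<and> range g \<subseteq> Im_quat \<and>
      (\<forall>p. (norm (g p - f p))\<^sup>2 = 1 / H\<^sup>2))"

end

(*
  Write T = fhat - f.  On Im H the Darboux equation on an edge with difference d is
  d + T' - T = (nu / mu) T' d^-1 T.  Put a = pi/M, b = k pi/(rho M), S = sin a cos b,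
  D = cos a sin b and r^2 = D^2 - S^2; then nu = -s^2 with s = r/(2S), and c_2 = eps (S + D)/r
  with eps = 1 or -1.  With p = (N - s)^n, q = (N + s)^n, u = (p^2 + q^2)/(2pq),
  v = (q^2 - p^2)/(2pq) and x = 2bm, the common factor 16 (S + D) p q cancels from T0, T1, C and
    T = -(2S/(r W)) (i D v + j eps e^(2iam) (S cos x - i D sin x)),  W = D u - eps r cos x.
  Here u^2 - v^2 = 1 and (u, v) satisfies a linear recurrence in n, so the edge equations become
  polynomial identities; moreover W never vanishes because D |u| > |r|.
  The Christoffel transform of fhat is f* + (1/nu) T^-1, where f* = i n/N - j e^(2iam) is the dual
  cylinder.  It has distance |f* - f| = 2 from fhat because 2 <f* - f, T> = |T|^2 + 1/nu.
*)
theory Submission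
  imports Defs
begin

subsection \<open>Darboux transforms of isothermic surfaces in the imaginary quaternions\<close>

text \<open>Quaternion products depend on the order of their factors, whereas edges carry no
  orientation. For imaginary points this obstacle disappears: the triple product in the Darboux
  equation is a real multiple of a difference of imaginary points, hence imaginary, hence equal to
  its reversal. So an edge may be traversed either way, and each side of a quadrilateral can be
  written in the order that makes cross-ratios telescope. The pair (u, v) is, up to a common sign,
  the hyperbolic cosine and sine of a multiple of n, because q/p = ((N + s)/(N - s))^n. The
  recurrence is the addition theorem, with s/N in the role of tanh of half a step. If |N| < s the
  ratio is negative and the sign of u alternates, which is why |u| and not u is bounded below. The
  value of \<nu> is tuned so that x advances by 2b in each step of m: after \<rho>M steps x has
  gained 2 pi k while the cylinder has been run through \<rho> times, and this closes the
  surface.\<close>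

lemma Im_quat_iff: "x \<in> Im_quat \<longleftrightarrow> QRe x = 0"
  by (simp add: Im_quat_def)

lemma Im_quat_diff: "x \<in> Im_quat \<Longrightarrow> y \<in> Im_quat \<Longrightarrow> x - y \<in> Im_quat"
  by (simp add: Im_quat_iff)

lemma Im_quat_scaleR: "x \<in> Im_quat \<Longrightarrow> c *\<^sub>R x \<in> Im_quat"
  by (simp add: Im_quat_iff)

lemma qcnj_mult: "qcnj (x * y) = qcnj y * qcnj x"
  by (simp add: quat_eq_iff algebra_simps)

lemma qcnj_of_real: "qcnj (of_real c) = of_real c"
  by (simp add: of_real_def quat_eq_iff)

lemma qcnj_Im: "x \<in> Im_quat \<Longrightarrow> qcnj x = - x"
  by (simp add: quat_eq_iff Im_quat_iff)

lemma inverse_Im: "x \<in> Im_quat \<Longrightarrow> inverse x = - ((1 / (norm x)\<^sup>2) *\<^sub>R x)"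
  by (simp add: inverse_quat_def qcnj_Im inverse_eq_divide)

lemma inverse_Im_in_Im: "x \<in> Im_quat \<Longrightarrow> inverse x \<in> Im_quat"
  by (simp add: inverse_Im Im_quat_iff)

text \<open>Conjugation reverses a product and negates imaginary quaternions, so it sends
  \<open>x * y * z\<close> to \<open>- (z * y * x)\<close>; the product, being imaginary itself, is
  also negated.\<close>

lemma triple_product_reverse:
  fixes x y z :: quat
  assumes "x \<in> Im_quat" "y \<in> Im_quat" "z \<in> Im_quat" "x * y * z \<in> Im_quat"
  shows "x * y * z = z * y * x"
proof -
  have "- (x * y * z) = qcnj (x * y * z)"
    using assms(4) by (simp add: qcnj_Im)
  also have "\<dots> = - (z * y * x)"
    using assms(1-3) by (simp add: qcnj_mult qcnj_Im mult.assoc)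
  finally show ?thesis by simp
qed

section \<open>The Darboux equation along an edge\<close>

lemma discrete_isothermic_edge:
  assumes "discrete_isothermic \<mu> f" "adjacent p q"
  shows "\<mu> p q = \<mu> q p" "\<mu> p q \<noteq> 0"
  using assms unfolding discrete_isothermic_def edge_function_def by blast+

text \<open>Solves the cross-ratio for the side \<open>c - d\<close>, which gives the Darboux
  equation along the edge from \<open>a\<close> to \<open>b\<close> with transformed points
  \<open>d\<close> and \<open>c\<close>. Distinctness makes the inverses genuine.\<close>

lemma cross_ratio_edge_iff:
  fixes a b c d :: quat
  assumes "a \<noteq> b" "b \<noteq> c" "d \<noteq> a"
  shows "cross_ratio a b c d = of_real \<kappa> \<longleftrightarrow>
    c - d = \<kappa> *\<^sub>R ((c - b) * inverse (b - a) * (d - a))"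
proof -
  have nz: "a - b \<noteq> 0" "b - c \<noteq> 0" "d - a \<noteq> 0"
    using assms by auto
  have "cross_ratio a b c d = of_real \<kappa> \<longleftrightarrow> (a - b) * inverse (b - c) * (c - d) = of_real \<kappa> * (d - a)"
    unfolding cross_ratio_def using nz(3)
    by (metis divide_inverse nonzero_divide_eq_eq mult.assoc)
  also have "\<dots> \<longleftrightarrow> c - d = (b - c) * inverse (a - b) * (of_real \<kappa> * (d - a))"
  proof
    assume eq: "(a - b) * inverse (b - c) * (c - d) = of_real \<kappa> * (d - a)"
    have "(b - c) * inverse (a - b) * ((a - b) * inverse (b - c) * (c - d))
        = (b - c) * (inverse (a - b) * (a - b)) * inverse (b - c) * (c - d)"
      by (simp only: mult.assoc)
    also have "\<dots> = c - d" using nz by simp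
    finally show "c - d = (b - c) * inverse (a - b) * (of_real \<kappa> * (d - a))"
      using eq by simp
  next
    assume eq: "c - d = (b - c) * inverse (a - b) * (of_real \<kappa> * (d - a))"
    have "(a - b) * inverse (b - c) * (c - d)
        = (a - b) * (inverse (b - c) * (b - c)) * inverse (a - b) * (of_real \<kappa> * (d - a))"
      unfolding eq by (simp only: mult.assoc)
    then show "(a - b) * inverse (b - c) * (c - d) = of_real \<kappa> * (d - a)"
      using nz by simp
  qed
  also have "(b - c) * inverse (a - b) * (of_real \<kappa> * (d - a))
      = \<kappa> *\<^sub>R ((c - b) * inverse (b - a) * (d - a))"
  proof -
    have "b - c = - (c - b)" "inverse (a - b) = - inverse (b - a)"
      by (simp_all flip: inverse_minus_eq)
    then show ?thesis
      by (simp only: minus_mult_minus) (simp add: of_real_def)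
  qed
  finally show ?thesis .
qed

lemma cross_ratio_nonzeroD:
  assumes "cross_ratio a b c d \<noteq> 0"
  shows "a \<noteq> b" "b \<noteq> c" "c \<noteq> d" "d \<noteq> a"
  using assms by (auto simp: cross_ratio_def)

text \<open>The condition \<open>\<kappa> \<noteq> 0\<close> serves twice: it forces consecutive
  points to be distinct, and division by it shows that the triple product is imaginary, so that its
  factors may be reversed.\<close>

lemma cross_ratio_edge_Im:
  assumes "a \<in> Im_quat" "b \<in> Im_quat" "c \<in> Im_quat" "d \<in> Im_quat"
    and "cross_ratio a b c d = of_real \<kappa>" "\<kappa> \<noteq> 0"
  shows "c - d = \<kappa> *\<^sub>R ((c - b) * inverse (b - a) * (d - a))"
    and "c - d = \<kappa> *\<^sub>R ((d - a) * inverse (b - a) * (c - b))"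
proof -
  have ne: "a \<noteq> b" "b \<noteq> c" "d \<noteq> a"
    using cross_ratio_nonzeroD[of a b c d] assms(5,6) by auto
  show 1: "c - d = \<kappa> *\<^sub>R ((c - b) * inverse (b - a) * (d - a))"
    using cross_ratio_edge_iff[OF ne] assms(5) by blast
  then have "(c - b) * inverse (b - a) * (d - a) = (1 / \<kappa>) *\<^sub>R (c - d)"
    using assms(6) by simp
  then have "(c - b) * inverse (b - a) * (d - a) \<in> Im_quat"
    using assms by (simp add: Im_quat_scaleR Im_quat_diff)
  with 1 show "c - d = \<kappa> *\<^sub>R ((d - a) * inverse (b - a) * (c - b))"
    using assms by (metis triple_product_reverse Im_quat_diff inverse_Im_in_Im)
qed

text \<open>Running through the edge backwards exchanges the outer factors and changes the sign of
  both sides. Hence the Darboux condition need only be checked on positively oriented edges.\<close>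

lemma cross_ratio_swap_Im:
  assumes "a \<in> Im_quat" "b \<in> Im_quat" "c \<in> Im_quat" "d \<in> Im_quat"
    and "cross_ratio a b c d = of_real \<kappa>" "\<kappa> \<noteq> 0"
  shows "cross_ratio b a d c = of_real \<kappa>"
proof -
  have ne: "b \<noteq> a" "a \<noteq> d" "c \<noteq> b"
    using cross_ratio_nonzeroD[of a b c d] assms(5,6) by auto
  have "d - c = - (c - d)" by simp
  also have "\<dots> = \<kappa> *\<^sub>R ((d - a) * (- inverse (b - a)) * (c - b))"
    using cross_ratio_edge_Im(2)[OF assms] by simp
  also have "- inverse (b - a) = inverse (a - b)"
    by (metis inverse_minus_eq minus_diff_eq)
  finally show ?thesis
    using cross_ratio_edge_iff[OF ne] by blast
qed

text \<open>The case \<open>swap\<close> keeps adjacency as a hypothesis, so that the symmetry of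
  \<mu> on edges is available there.\<close>

lemma edge_induct [consumes 1, case_names horizontal vertical swap]:
  assumes "adjacent p q"
    and "\<And>m n. P (m, n) (m + 1, n)" "\<And>m n. P (m, n) (m, n + 1)"
    and "\<And>p q. adjacent p q \<Longrightarrow> P p q \<Longrightarrow> P q p"
  shows "P p q"
proof -
  obtain m n m' n' where pq: "p = (m, n)" "q = (m', n')"
    by (metis surj_pair)
  have "\<bar>m - m'\<bar> + \<bar>n - n'\<bar> = 1"
    using assms(1) by (simp add: pq adjacent_def)
  then consider "m' = m + 1" "n' = n" | "m = m' + 1" "n' = n"
    | "m' = m" "n' = n + 1" | "m' = m" "n = n' + 1"
    by linarith
  then show ?thesis
  proof cases
    case 1 then show ?thesis using assms(2) by (simp add: pq)
  next
    case 2
    have "P (m', n') (m' + 1, n')" by (rule assms(2))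
    then show ?thesis using assms(4)[of "(m', n')" "(m' + 1, n')"] 2
      by (simp add: pq adjacent_def)
  next
    case 3 then show ?thesis using assms(3) by (simp add: pq)
  next
    case 4
    have "P (m', n') (m', n' + 1)" by (rule assms(3))
    then show ?thesis using assms(4)[of "(m', n')" "(m', n' + 1)"] 4
      by (simp add: pq adjacent_def)
  qed
qed

lemma
  assumes "darboux_transform \<mu> \<nu> f g" "adjacent p q" "\<nu> \<noteq> 0"
    and "range f \<subseteq> Im_quat" "range g \<subseteq> Im_quat"
  shows darboux_edge: "g q - g p = (\<nu> / \<mu> p q) *\<^sub>R ((g q - f q) * inverse (f q - f p) * (g p - f p))"
    and darboux_edge': "g q - g p = (\<nu> / \<mu> p q) *\<^sub>R ((g p - f p) * inverse (f q - f p) * (g q - f q))"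
    and darboux_edge_nonzero: "f q - f p \<noteq> 0" "g q - g p \<noteq> 0"
proof -
  have "\<mu> p q \<noteq> 0"
    using assms(1,2) discrete_isothermic_edge(2) unfolding darboux_transform_def by blast
  then have nz: "\<nu> / \<mu> p q \<noteq> 0" using assms(3) by simp
  have cr: "cross_ratio (f p) (f q) (g q) (g p) = of_real (\<nu> / \<mu> p q)"
    using assms(1,2) unfolding darboux_transform_def by blast
  have im: "f p \<in> Im_quat" "f q \<in> Im_quat" "g q \<in> Im_quat" "g p \<in> Im_quat"
    using assms(4,5) by auto
  show "g q - g p = (\<nu> / \<mu> p q) *\<^sub>R ((g q - f q) * inverse (f q - f p) * (g p - f p))"
    "g q - g p = (\<nu> / \<mu> p q) *\<^sub>R ((g p - f p) * inverse (f q - f p) * (g q - f q))"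
    using cross_ratio_edge_Im[OF im cr nz] by blast+
  show "f q - f p \<noteq> 0" "g q - g p \<noteq> 0"
    using cross_ratio_nonzeroD(1,3)[of "f p" "f q" "g q" "g p"] nz
    unfolding cr of_real_eq_0_iff by auto
qed

text \<open>A real value is fixed by conjugation, which reverses the four imaginary factors with an
  even number of signs; inverting then restores their order with each factor inverted.\<close>

lemma cross_ratio_reverse_Im:
  assumes "a \<in> Im_quat" "b \<in> Im_quat" "c \<in> Im_quat" "d \<in> Im_quat"
    and "cross_ratio a b c d = of_real \<kappa>"
  shows "inverse (a - b) * (b - c) * inverse (c - d) * (d - a) = of_real (1 / \<kappa>)"
proof -
  have im: "a - b \<in> Im_quat" "c - d \<in> Im_quat"
    "inverse (b - c) \<in> Im_quat" "inverse (d - a) \<in> Im_quat"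
    using assms by (simp_all add: Im_quat_diff inverse_Im_in_Im)
  have "of_real \<kappa> = qcnj (cross_ratio a b c d)"
    using assms(5) by (simp add: qcnj_of_real)
  also have "\<dots> = inverse (d - a) * (c - d) * inverse (b - c) * (a - b)"
    unfolding cross_ratio_def qcnj_mult im[THEN qcnj_Im] minus_mult_minus mult.assoc
    by (simp add: qcnj_Im[OF im(1)] qcnj_Im[OF im(2)])
  finally have eq: "inverse (inverse (d - a) * (c - d) * inverse (b - c) * (a - b)) = of_real (1 / \<kappa>)"
    by (simp add: inverse_eq_divide[symmetric])
  have inv: "inverse (x * y) = inverse y * inverse x" for x y :: quat
    by (cases "x = 0 \<or> y = 0") (auto simp: nonzero_inverse_mult_distrib)
  show ?thesis
    using eq by (simp add: inv mult.assoc)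
qed

text \<open>With T = g - f, the cross-ratio of \<open>g\<close> telescopes to the reciprocal-type
  cross-ratio of \<open>f\<close> conjugated by T at \<open>i\<close>. The latter is real, so the
  conjugation has no effect.\<close>

lemma darboux_isothermic:
  assumes D: "darboux_transform \<mu> \<nu> f g" and "\<nu> \<noteq> 0"
    and "range f \<subseteq> Im_quat" "range g \<subseteq> Im_quat"
  shows "discrete_isothermic \<mu> g"
proof -
  have iso: "discrete_isothermic \<mu> f" and ne: "\<And>p. g p - f p \<noteq> 0"
    using D by (auto simp: darboux_transform_def)
  have inv: "inverse (x * y) = inverse y * inverse x" if "x \<noteq> 0" "y \<noteq> 0" for x y :: quat
    using that by (rule nonzero_inverse_mult_distrib)
  have "cross_ratio (g i) (g j) (g k) (g l) = of_real (\<mu> i l / \<mu> i j)"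
    if v: "i = (m, n)" "j = (m + 1, n)" "k = (m + 1, n + 1)" "l = (m, n + 1)" for m n i j k l
  proof -
    have adj: "adjacent j i" "adjacent k j" "adjacent l k" "adjacent i l"
      by (simp_all add: v adjacent_def)
    have ef: "\<mu> p q = \<mu> q p \<and> \<mu> p q \<noteq> 0" if "adjacent p q" for p q
      using discrete_isothermic_edge[OF iso that] by blast
    have \<mu>: "\<mu> j i = \<mu> i j" "\<mu> l k = \<mu> i j" "\<mu> k j = \<mu> i l" "\<mu> i j \<noteq> 0" "\<mu> i l \<noteq> 0"
      and cr: "cross_ratio (f i) (f j) (f k) (f l) = of_real (\<mu> i l / \<mu> i j)"
      using iso adj[THEN ef] unfolding discrete_isothermic_def Let_def v by metis+
    have rev: "inverse (f i - f j) * (f j - f k) * inverse (f k - f l) * (f l - f i)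
        = of_real (1 / (\<mu> i l / \<mu> i j))"
      using assms(3) by (intro cross_ratio_reverse_Im cr) auto
    note E = darboux_edge[OF D _ assms(2-)] darboux_edge'[OF D _ assms(2-)]
    note nz = darboux_edge_nonzero[OF D _ assms(2-)]
    \<comment> \<open>The factor orders alternate so that, once the second and fourth differences
      are inverted, the inner factors at \<open>j\<close>, \<open>k\<close> and \<open>l\<close>
      meet their inverses.\<close>
    have ed: "g i - g j = (\<nu> / \<mu> i j) *\<^sub>R ((g i - f i) * inverse (f i - f j) * (g j - f j))"
      "g j - g k = (\<nu> / \<mu> i l) *\<^sub>R ((g k - f k) * inverse (f j - f k) * (g j - f j))"
      "g k - g l = (\<nu> / \<mu> i j) *\<^sub>R ((g k - f k) * inverse (f k - f l) * (g l - f l))"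
      "g l - g i = (\<nu> / \<mu> i l) *\<^sub>R ((g i - f i) * inverse (f l - f i) * (g l - f l))"
      using E(1)[OF adj(1)] E(2)[OF adj(2)] E(1)[OF adj(3)] E(2)[OF adj(4)] by (simp_all add: \<mu>)
    have inv3: "inverse (c *\<^sub>R (x * inverse y * z)) = (1 / c) *\<^sub>R (inverse z * y * inverse x)"
      if "x \<noteq> 0" "y \<noteq> 0" "z \<noteq> 0" for c and x y z :: quat
      using that by (simp add: inverse_scaleR_distrib inv mult.assoc inverse_eq_divide[of c])
    have ie: "inverse (g j - g k) = (\<mu> i l / \<nu>) *\<^sub>R (inverse (g j - f j) * (f j - f k) * inverse (g k - f k))"
      "inverse (g l - g i) = (\<mu> i l / \<nu>) *\<^sub>R (inverse (g l - f l) * (f l - f i) * inverse (g i - f i))"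
      unfolding ed(2,4) using ne nz(1)[OF adj(2)] nz(1)[OF adj(4)]
      by (simp_all add: inv3)
    have cancel: "inverse (g j - f j) * ((g j - f j) * x) = x" 
      "(g j - f j) * (inverse (g j - f j) * x) = x" 
      "inverse (g k - f k) * ((g k - f k) * x) = x"
      "(g l - f l) * (inverse (g l - f l) * x) = x" for x
      using ne by (simp_all add: mult.assoc[symmetric])
    have "cross_ratio (g i) (g j) (g k) (g l)
        = (\<mu> i l / \<mu> i j)\<^sup>2 *\<^sub>R ((g i - f i) *
          (inverse (f i - f j) * (f j - f k) * inverse (f k - f l) * (f l - f i)) * inverse (g i - f i))"
      unfolding cross_ratio_def ie ed(1,3) using assms(2) \<mu>
      by (simp add: mult.assoc cancel power2_eq_square)
    also have "\<dots> = of_real (\<mu> i l / \<mu> i j)"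
      unfolding rev using ne[of i] \<mu> by (simp add: of_real_def power2_eq_square)
    finally show ?thesis .
  qed
  with iso show ?thesis
    unfolding discrete_isothermic_def Let_def by blast
qed

text \<open>With T = g - f, multiply d + T' - T = (\<nu>/\<mu>) T d^-1 T' by T^-1 on the left and
  T'^-1 on the right. This expresses T^-1 d T'^-1, which is \<nu>/\<mu> times the inverse of the
  increment of \<open>g\<close>, through d^-1 and the difference of T'^-1 and T^-1.\<close>

lemma darboux_christoffel:
  assumes D: "darboux_transform \<mu> \<nu> f g" and "\<nu> \<noteq> 0"
    and "range f \<subseteq> Im_quat" "range g \<subseteq> Im_quat"
    and C: "christoffel_transform \<mu> f h"
  shows "christoffel_transform \<mu> g (\<lambda>p. h p + (1 / \<nu>) *\<^sub>R inverse (g p - f p))"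
  unfolding christoffel_transform_def
proof (intro conjI allI impI)
  show "discrete_isothermic \<mu> g"
    using assms by (rule_tac darboux_isothermic)
  fix p q assume adj: "adjacent p q"
  have m: "\<mu> p q \<noteq> 0" 
    using D adj discrete_isothermic_edge(2) unfolding darboux_transform_def by blast
  define x y d where "x = g p - f p" and "y = g q - f q" and "d = f q - f p"
  have nz: "x \<noteq> 0" "y \<noteq> 0" "d \<noteq> 0"
    using D darboux_edge_nonzero(1)[OF D adj assms(2-4)]
    unfolding darboux_transform_def x_def y_def d_def right_minus_eq by blast+
  have gd: "g q - g p = (\<nu> / \<mu> p q) *\<^sub>R (x * inverse d * y)"
    using darboux_edge'[OF D adj assms(2-4)] by (simp add: x_def y_def d_def)
  have gd': "g q - g p = d + y - x"
    by (simp add: x_def y_def d_def)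
  have "inverse x * (g q - g p) * inverse y = (\<nu> / \<mu> p q) *\<^sub>R inverse d"
  proof -
    have "inverse x * (x * inverse d * y) * inverse y = (inverse x * x) * inverse d * (y * inverse y)"
      by (simp only: mult.assoc)
    then show ?thesis unfolding gd using nz by simp
  qed
  moreover have "inverse x * (g q - g p) * inverse y = inverse x * d * inverse y + inverse x - inverse y"
    unfolding gd' using nz by (simp add: algebra_simps)
  ultimately have e: "inverse x * d * inverse y = (\<nu> / \<mu> p q) *\<^sub>R inverse d - inverse x + inverse y"
    by (simp add: algebra_simps)
  have "inverse (g q - g p) = (\<mu> p q / \<nu>) *\<^sub>R inverse (x * inverse d * y)"
    unfolding gd by (simp add: inverse_scaleR_distrib)
  also have "inverse (x * inverse d * y) = inverse y * d * inverse x"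
    using nz by (simp add: nonzero_inverse_mult_distrib mult.assoc)
  \<comment> \<open>Both factor orders of the Darboux equation hold, and this is their inverted
    form.\<close>
  also have "inverse y * d * inverse x = inverse x * d * inverse y"
  proof -
    have "g q - g p = (\<nu> / \<mu> p q) *\<^sub>R (y * inverse d * x)"
      using darboux_edge[OF D adj assms(2-4)] by (simp add: x_def y_def d_def)
    then have "x * inverse d * y = y * inverse d * x"
      using gd m \<open>\<nu> \<noteq> 0\<close> by simp
    then have "inverse (x * inverse d * y) = inverse (y * inverse d * x)" by simp
    then show ?thesis
      using nz by (simp add: nonzero_inverse_mult_distrib mult.assoc)
  qed
  finally have "(1 / \<mu> p q) *\<^sub>R inverse (g q - g p)
      = (1 / \<mu> p q) *\<^sub>R inverse d + (1 / \<nu>) *\<^sub>R (inverse y - inverse x)"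
    unfolding e using m \<open>\<nu> \<noteq> 0\<close> by (simp add: scaleR_add_right scaleR_diff_right)
  moreover have "inverse (g q - g p) = - inverse (g p - g q)" "inverse d = - inverse (f p - f q)"
    unfolding d_def by (metis inverse_minus_eq minus_diff_eq)+
  ultimately have "(1 / \<mu> p q) *\<^sub>R inverse (g p - g q)
      = (1 / \<mu> p q) *\<^sub>R inverse (f p - f q) - (1 / \<nu>) *\<^sub>R (inverse y - inverse x)"
    by (metis add_diff_cancel_right' diff_minus_eq_add minus_add_distrib minus_minus scaleR_minus_right uminus_add_conv_diff)
  moreover have "(1 / \<mu> p q) *\<^sub>R inverse (f p - f q) = h p - h q"
    using C adj unfolding christoffel_transform_def by metis
  ultimately show "h p + (1 / \<nu>) *\<^sub>R inverse (g p - f p) - (h q + (1 / \<nu>) *\<^sub>R inverse (g q - f q))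
      = (1 / \<mu> p q) *\<^sub>R inverse (g p - g q)"
    unfolding x_def y_def by (simp only: scaleR_diff_right) simp
qed

subsection \<open>Quaternions as pairs of complex numbers\<close>

text \<open>The splitting of the quaternions as C + jC in which the surfaces are given. Moving a
  complex number past j conjugates it; this is the origin of \<open>cnj\<close> in the product rule
  below, and j i = -k that of the sign in \<open>QK\<close>.\<close>

definition quat_pair :: "complex \<Rightarrow> complex \<Rightarrow> quat" where
  "quat_pair x y = quat_of_complex x + quat_j * quat_of_complex y"

lemma quat_pair_sel [simp]:
  "QRe (quat_pair x y) = Re x" "QI (quat_pair x y) = Im x"
  "QJ (quat_pair x y) = Re y" "QK (quat_pair x y) = - Im y"
  by (simp_all add: quat_pair_def quat_of_complex_def quat_j_def)

lemma quat_pair_eq_iff [simp]: "quat_pair x y = quat_pair x' y' \<longleftrightarrow> x = x' \<and> y = y'"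
  by (auto simp: quat_eq_iff complex_eq_iff)

lemma quat_pair_eq_0_iff: "quat_pair x y = 0 \<longleftrightarrow> x = 0 \<and> y = 0"
  by (auto simp: quat_eq_iff complex_eq_iff)

lemma quat_pair_algebra:
  "quat_pair x y + quat_pair x' y' = quat_pair (x + x') (y + y')"
  "quat_pair x y - quat_pair x' y' = quat_pair (x - x') (y - y')"
  "c *\<^sub>R quat_pair x y = quat_pair (of_real c * x) (of_real c * y)"
  "quat_pair x y * quat_pair x' y' = quat_pair (x * x' - cnj y * y') (y * x' + cnj x * y')"
  by (simp_all add: quat_eq_iff algebra_simps)

lemma norm_quat_pair: "(norm (quat_pair x y))\<^sup>2 = (cmod x)\<^sup>2 + (cmod y)\<^sup>2"
  unfolding power2_norm_quat inner_quat_def cmod_power2 by (simp add: power2_eq_square)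

lemma quat_pair_in_Im: "quat_pair x y \<in> Im_quat \<longleftrightarrow> Re x = 0"
  by (simp add: Im_quat_iff)

lemma inverse_quat_pair_Im:
  "Re x = 0 \<Longrightarrow> inverse (quat_pair x y) = - ((1 / ((cmod x)\<^sup>2 + (cmod y)\<^sup>2)) *\<^sub>R quat_pair x y)"
  using inverse_Im[of "quat_pair x y"] by (simp add: Im_quat_iff norm_quat_pair)

subsection \<open>The circular cylinder and its dual\<close>

lemma norm_cis_diff: "cmod (cis (x + y) - cis x) = cmod (1 - cis y)"
proof -
  have "cis (x + y) - cis x = - (cis x * (1 - cis y))"
    by (simp add: cis_mult[symmetric] algebra_simps)
  then show ?thesis by (simp add: norm_mult)
qed

text \<open>Inverting an imaginary edge vector d gives -d/|d|^2. The factor 1/\<mu> is |d|^2 on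
  horizontal and -|d|^2 on vertical edges, so the dual surface reverses the circular direction and
  keeps the axial one.\<close>

lemma
  fixes a N :: real and f :: "vertex \<Rightarrow> quat"
  assumes f: "\<And>m n. f (m, n) = quat_pair (\<i> * of_real (of_int n / N)) (cis (2 * a * of_int m))"
    and \<mu>: "edge_function \<mu>"
      "\<And>m n. 1 / \<mu> (m, n) (m + 1, n) = (cmod (1 - cis (2 * a)))\<^sup>2"
      "\<And>m n. 1 / \<mu> (m, n) (m, n + 1) = - (1 / N\<^sup>2)"
    and "N \<noteq> 0"
  shows circular_cylinder_isothermic: "discrete_isothermic \<mu> f"
    and circular_cylinder_christoffel: "christoffel_transform \<mu> f
      (\<lambda>(m, n). quat_pair (\<i> * of_real (of_int n / N)) (- cis (2 * a * of_int m)))"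
proof -
  have cd: "cmod (cis (2 * a * of_int m) - cis (2 * a * of_int (m + 1))) = cmod (1 - cis (2 * a))" for m
    using norm_cis_diff[of "2 * a * of_int m" "2 * a"] by (simp add: norm_minus_commute algebra_simps)
  have nz: "\<mu> (m, n) (m + 1, n) \<noteq> 0" for m n
    using \<mu>(1) by (simp add: edge_function_def adjacent_def)
  \<comment> \<open>A nonzero \<mu> has a nonzero reciprocal, so the prescribed value of 1/\<mu>
    already excludes a degenerate circle.\<close>
  then have cz: "1 - cis (2 * a) \<noteq> 0"
    using nz[of 0 0] \<mu>(2)[of 0 0]
    by (metis divide_eq_0_iff norm_zero power_zero_numeral zero_neq_one)
  have \<mu>h: "\<mu> (m, n) (m + 1, n) = 1 / (cmod (1 - cis (2 * a)))\<^sup>2" for m n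
    using \<mu>(2)[of m n] by (metis inverse_eq_divide inverse_inverse_eq)
  have \<mu>v: "\<mu> (m, n) (m, n + 1) = - N\<^sup>2" for m n
    using arg_cong[OF \<mu>(3)[of m n], of inverse] by (simp add: inverse_eq_divide)
  have fh: "f (m, n) - f (m + 1, n) = quat_pair 0 (cis (2 * a * of_int m) - cis (2 * a * of_int (m + 1)))"
    and fv: "f (m, n) - f (m, n + 1) = quat_pair (- \<i> / of_real N) 0" for m n
    unfolding f quat_pair_algebra quat_pair_eq_iff using \<open>N \<noteq> 0\<close> by (simp_all add: field_simps)
  have iv: "inverse (quat_pair (- \<i> / of_real N) 0) = quat_pair (\<i> * of_real N) 0"
    using \<open>N \<noteq> 0\<close>
    by (simp add: inverse_quat_pair_Im norm_divide quat_eq_iff power2_eq_square)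
  show iso: "discrete_isothermic \<mu> f"
    unfolding discrete_isothermic_def Let_def
  proof (intro conjI allI \<mu>(1))
    fix m n
    show "\<mu> (m, n) (m + 1, n) = \<mu> (m + 1, n + 1) (m, n + 1)"
      using \<mu>h \<mu>(1) by (simp add: edge_function_def adjacent_def)
    show "\<mu> (m, n) (m, n + 1) = \<mu> (m + 1, n) (m + 1, n + 1)"
      by (simp add: \<mu>v)
    \<comment> \<open>Opposite sides are parallel, so the cross-ratio depends on \<open>y\<close>
      only through its modulus and equals \<open>- N\<^sup>2 * (cmod y)\<^sup>2\<close>.\<close>
    define y where "y = cis (2 * a * of_int m) - cis (2 * a * of_int (m + 1))"
    have y: "cnj y * y = of_real ((cmod (1 - cis (2 * a)))\<^sup>2)"
      by (metis complex_norm_square mult.commute of_real_power y_def cd)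
    have e: "f (m, n) - f (m + 1, n) = quat_pair 0 y"
      "f (m + 1, n) - f (m + 1, n + 1) = quat_pair (- \<i> / of_real N) 0"
      "f (m + 1, n + 1) - f (m, n + 1) = - quat_pair 0 y"
      "f (m, n + 1) - f (m, n) = - quat_pair (- \<i> / of_real N) 0"
      using fh[of m n] fh[of m "n + 1"] fv[of "m + 1" n] fv[of m n]
      unfolding y_def by (metis minus_diff_eq)+
    show "cross_ratio (f (m, n)) (f (m + 1, n)) (f (m + 1, n + 1)) (f (m, n + 1))
        = of_real (\<mu> (m, n) (m, n + 1) / \<mu> (m, n) (m + 1, n))"
      unfolding cross_ratio_def e inverse_minus_eq iv \<mu>h \<mu>v
      using arg_cong[OF y, of "\<lambda>z. N * (N * Re z)"]
      by (simp add: quat_eq_iff of_real_def power2_eq_square algebra_simps)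
  qed
  show "christoffel_transform \<mu> f
      (\<lambda>(m, n). quat_pair (\<i> * of_real (of_int n / N)) (- cis (2 * a * of_int m)))" (is "christoffel_transform \<mu> f ?g")
    unfolding christoffel_transform_def
  proof (intro conjI allI impI iso)
    fix p q assume "adjacent p q"
    then show "?g p - ?g q = (1 / \<mu> p q) *\<^sub>R inverse (f p - f q)"
    proof (induction rule: edge_induct)
      case (horizontal m n)
      show ?case
        unfolding fh \<mu>(2) using cz
        by (simp add: inverse_quat_pair_Im cd[simplified] quat_pair_algebra) (simp add: quat_eq_iff)
    next
      case (vertical m n)
      show ?case
        unfolding fv iv \<mu>(3) quat_pair_algebra case_prod_conv quat_pair_eq_iff
        using \<open>N \<noteq> 0\<close> by (simp add: field_simps power2_eq_square)
    next
      case (swap p q)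
      have "inverse (f q - f p) = - inverse (f p - f q)"
        by (metis inverse_minus_eq minus_diff_eq)
      moreover have "?g q - ?g p = - (?g p - ?g q)"
        by (rule minus_diff_eq[symmetric])
      ultimately show ?case
        unfolding swap(2) discrete_isothermic_edge(1)[OF iso swap(1)] by (simp only: scaleR_minus_right)
    qed
  qed
qed

subsection \<open>Darboux transforms of the circular cylinder\<close>

text \<open>The numerator of T = fhat - f without the scalar -2S/(rW); separating it turns the edge
  equations into polynomial identities. The unit \<open>e\<close> stands for e^(2iam).\<close>

definition cyl_vec :: "real \<Rightarrow> real \<Rightarrow> real \<Rightarrow> real \<Rightarrow> real \<Rightarrow> complex \<Rightarrow> quat" where
  "cyl_vec a b \<epsilon> v x e = quat_pair (\<i> * of_real (cos a * sin b * v))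
     (e * of_real \<epsilon> * Complex (sin a * cos b * cos x) (- (cos a * sin b * sin x)))"

text \<open>The edge equation multiplied by both denominators. Placing \<open>\<phi>\<close> and
  \<open>\<eta>\<close> at the midpoint of the edge gives the ends the angles
  \<open>\<phi> - b\<close> and \<open>\<phi> + b\<close> and exposes a symmetry: after removal of
  \<open>\<eta>\<close>, the j-components of the two ends have the same real part.\<close>

lemma cyl_vec_horizontal:
  fixes a b \<phi> u v r \<epsilon> :: real and \<eta> :: complex
  defines "S \<equiv> sin a * cos b" and "D \<equiv> cos a * sin b"
  defines "W \<equiv> \<lambda>x. D * u - \<epsilon> * r * cos x"
  defines "V \<equiv> \<lambda>x e. cyl_vec a b \<epsilon> v x e"
  assumes r: "r\<^sup>2 = D\<^sup>2 - S\<^sup>2" "r \<noteq> 0" and "\<epsilon>\<^sup>2 = 1" and "u\<^sup>2 - v\<^sup>2 = 1" and \<eta>: "cmod \<eta> = 1"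
  shows "(W (\<phi> - b) * W (\<phi> + b)) *\<^sub>R quat_pair 0 (\<eta> * (cis a - cis (- a)))
      - (2 * S / r) *\<^sub>R (W (\<phi> - b) *\<^sub>R V (\<phi> + b) (\<eta> * cis a) - W (\<phi> + b) *\<^sub>R V (\<phi> - b) (\<eta> * cis (- a)))
    = V (\<phi> + b) (\<eta> * cis a) * quat_pair 0 (\<eta> * (cis a - cis (- a))) * V (\<phi> - b) (\<eta> * cis (- a))"
proof -
  define z z' where "z = of_real \<epsilon> * (cis (- a) * Complex (S * cos (\<phi> - b)) (- (D * sin (\<phi> - b))))"
    and "z' = of_real \<epsilon> * (cis a * Complex (S * cos (\<phi> + b)) (- (D * sin (\<phi> + b))))"
  define y y' where "y = - ((sin a)\<^sup>2 * cos b * cos (\<phi> - b) + (cos a)\<^sup>2 * sin b * sin (\<phi> - b))"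
    and "y' = (sin a)\<^sup>2 * cos b * cos (\<phi> + b) - (cos a)\<^sup>2 * sin b * sin (\<phi> + b)"
  \<comment> \<open>Writing \<open>cos \<phi>\<close> from either end shows that \<open>z\<close>
    and \<open>z'\<close> have the common real part
    \<open>\<epsilon> * sin a * cos a * cos \<phi>\<close>.\<close>
  have cb: "cos \<phi> = cos (\<phi> - b) * cos b - sin (\<phi> - b) * sin b"
    "cos \<phi> = cos (\<phi> + b) * cos b + sin (\<phi> + b) * sin b"
    using cos_add[of "\<phi> - b" b] cos_diff[of "\<phi> + b" b] by auto
  have z: "z = of_real \<epsilon> * Complex (sin a * cos a * cos \<phi>) y"
    unfolding z_def y_def cb(1) S_def D_def
    by (simp add: complex_eq_iff algebra_simps power2_eq_square)
  have z': "z' = of_real \<epsilon> * Complex (sin a * cos a * cos \<phi>) y'"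
    unfolding z'_def y'_def cb(2) S_def D_def
    by (simp add: complex_eq_iff algebra_simps power2_eq_square)
  have \<eta>2: "cnj \<eta> * \<eta> = 1"
    using \<eta> by (metis complex_norm_square mult.commute of_real_1 power_one)
  have Vz: "V (\<phi> - b) (\<eta> * cis (- a)) = quat_pair (\<i> * of_real (D * v)) (\<eta> * z)"
    and Vz': "V (\<phi> + b) (\<eta> * cis a) = quat_pair (\<i> * of_real (D * v)) (\<eta> * z')"
    by (simp_all add: V_def cyl_vec_def z_def z'_def S_def D_def mult_ac)
  have d: "\<eta> * (cis a - cis (- a)) = \<eta> * (2 * \<i> * of_real (sin a))"
    by (simp add: complex_eq_iff)
  have sc: "(sin a)\<^sup>2 + (cos a)\<^sup>2 = 1" "(sin b)\<^sup>2 + (cos b)\<^sup>2 = 1" "(sin \<phi>)\<^sup>2 + (cos \<phi>)\<^sup>2 = 1"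
    by simp_all
  have yy: "y + y' = - 2 * sin b * cos b * sin \<phi>"
    using sc unfolding y_def y'_def cos_add sin_add cos_diff sin_diff by algebra
  have yd: "y' - y = - 2 * r\<^sup>2 * cos \<phi>"
    unfolding r y_def y'_def D_def S_def cos_add sin_add cos_diff sin_diff
    by (simp add: algebra_simps power2_eq_square)
  have WW: "W (\<phi> - b) - W (\<phi> + b) = - 2 * \<epsilon> * r * sin \<phi> * sin b"
    unfolding W_def cos_add cos_diff by (simp add: algebra_simps)
  have WS: "W (\<phi> - b) * W (\<phi> + b) = D\<^sup>2 * u\<^sup>2 - 2 * \<epsilon> * r * D * u * cos \<phi> * cos b
      + r\<^sup>2 * cos (\<phi> - b) * cos (\<phi> + b)"
    using \<open>\<epsilon>\<^sup>2 = 1\<close> unfolding W_def cos_add cos_diff by algebra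
  have yW: "y' * W (\<phi> - b) - y * W (\<phi> + b) = - 2 * r\<^sup>2 * cos \<phi> * D * u
      - \<epsilon> * r * (y' * cos (\<phi> - b) - y * cos (\<phi> + b))"
    using yd unfolding W_def by algebra
  \<comment> \<open>The part of \<open>im\<close> free of \<open>u\<close> and \<open>v\<close>: the
    terms linear in \<open>u\<close> cancel because \<open>S = sin a * cos b\<close>, and
    \<open>u\<^sup>2 - v\<^sup>2 = 1\<close> leaves only \<open>D\<^sup>2\<close>.\<close>
  have key: "r\<^sup>2 * cos (\<phi> - b) * cos (\<phi> + b) + cos b * (y' * cos (\<phi> - b) - y * cos (\<phi> + b))
      = - D\<^sup>2 + (sin a * cos a * cos \<phi>)\<^sup>2 - y * y'"
    using sc unfolding r y_def y'_def D_def S_def cos_add sin_add cos_diff sin_diff by algebra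
  \<comment> \<open>Up to sign, \<open>i1\<close> is the complex component of the claim;
    \<open>i2\<close> is its j-component divided by \<open>\<eta>\<close>. Real and imaginary part
    of \<open>i2\<close> are \<open>re\<close> and \<open>im\<close> with common factors
    removed.\<close>
  have i1: "of_real (2 * S / r) * (\<i> * of_real (D * v) * of_real (W (\<phi> - b) - W (\<phi> + b)))
     = 2 * of_real (sin a) * of_real (D * v) * (z - cnj z')"
  proof -
    have "z - cnj z' = \<i> * of_real (\<epsilon> * (y + y'))"
      unfolding z z' by (simp add: complex_eq_iff algebra_simps)
    then show ?thesis
      unfolding WW yy S_def using r(2) by (simp add: complex_eq_iff)
  qed
  have re: "(S / r) * (W (\<phi> - b) - W (\<phi> + b)) * \<epsilon> = sin a * (y + y')"
    unfolding WW yy S_def using r(2) \<open>\<epsilon>\<^sup>2 = 1\<close> by (simp add: power2_eq_square field_simps)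
  have im: "sin a * (W (\<phi> - b) * W (\<phi> + b)) - (S / r) * \<epsilon> * (y' * W (\<phi> - b) - y * W (\<phi> + b))
     = sin a * ((D * v)\<^sup>2 + (sin a * cos a * cos \<phi>)\<^sup>2 - y * y')"
  proof -
    have "(S / r) * \<epsilon> * (y' * W (\<phi> - b) - y * W (\<phi> + b))
      = S * (- 2 * \<epsilon> * r * cos \<phi> * D * u - (y' * cos (\<phi> - b) - y * cos (\<phi> + b)))"
      unfolding yW using r(2) \<open>\<epsilon>\<^sup>2 = 1\<close> by (simp add: power2_eq_square field_simps) algebra
    then show ?thesis
      using key \<open>u\<^sup>2 - v\<^sup>2 = 1\<close> unfolding WS S_def by algebra
  qed
  have ee: "\<epsilon> * (\<epsilon> * t) = t" for t
    using \<open>\<epsilon>\<^sup>2 = 1\<close> by (simp add: power2_eq_square flip: mult.assoc)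
  have i2: "of_real (W (\<phi> - b) * W (\<phi> + b)) * (2 * \<i> * of_real (sin a))
     - of_real (2 * S / r) * (of_real (W (\<phi> - b)) * z' - of_real (W (\<phi> + b)) * z)
     = 2 * \<i> * of_real (sin a) * (of_real ((D * v)\<^sup>2) + z * z')" (is "?l = ?r")
  proof -
    have "Re ?l = Re ?r"
      using re unfolding z z' by (simp add: ee power2_eq_square algebra_simps diff_divide_distrib) algebra
    moreover have "Im ?l = Im ?r"
      using arg_cong[OF im, of "\<lambda>x. 2 * x"] unfolding z z' by (simp add: ee power2_eq_square algebra_simps diff_divide_distrib)
    ultimately show ?thesis by (simp add: complex_eq_iff)
  qed
  have \<eta>3: "cnj (\<eta> * x) * (\<eta> * x') = cnj x * x'" for x x'
    using \<eta>2 by (simp add: mult_ac)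
  have "cnj (cnj (\<i> * of_real (D * v)) * (\<eta> * (2 * \<i> * of_real (sin a)))) * (\<eta> * z) =
     2 * of_real (sin a) * of_real (D * v) * z"
    using \<eta>3[of "cnj (\<i> * of_real (D * v)) * (2 * \<i> * of_real (sin a))" z] by (simp add: mult_ac)
  with i1 have s: "of_real (W (\<phi> - b) * W (\<phi> + b)) * 0 -
    of_real (2 * S / r) * (of_real (W (\<phi> - b)) * (\<i> * of_real (D * v)) - of_real (W (\<phi> + b)) * (\<i> * of_real (D * v))) =
    (\<i> * of_real (D * v) * 0 - cnj (\<eta> * z') * (\<eta> * (2 * \<i> * of_real (sin a)))) * (\<i> * of_real (D * v)) -
    cnj (\<eta> * z' * 0 + cnj (\<i> * of_real (D * v)) * (\<eta> * (2 * \<i> * of_real (sin a)))) * (\<eta> * z)"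
    unfolding \<eta>3 by (simp add: algebra_simps)
  show ?thesis
    unfolding Vz Vz' d quat_pair_algebra quat_pair_eq_iff
  proof (intro conjI)
    show "of_real (W (\<phi> - b) * W (\<phi> + b)) * (\<eta> * (2 * \<i> * of_real (sin a))) -
      of_real (2 * S / r) * (of_real (W (\<phi> - b)) * (\<eta> * z') - of_real (W (\<phi> + b)) * (\<eta> * z)) =
      (\<eta> * z' * 0 + cnj (\<i> * of_real (D * v)) * (\<eta> * (2 * \<i> * of_real (sin a)))) * (\<i> * of_real (D * v)) +
      cnj (\<i> * of_real (D * v) * 0 - cnj (\<eta> * z') * (\<eta> * (2 * \<i> * of_real (sin a)))) * (\<eta> * z)"
      unfolding \<eta>3
      using arg_cong[OF i2, of "\<lambda>x. \<eta> * x"] by (simp add: algebra_simps power2_eq_square)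
  qed (use s in simp)
qed

text \<open>Along a vertical edge \<open>x\<close> and \<open>e\<close> are fixed, so both ends
  share the j-component \<open>y\<close>; only the real relations between (u, v) and (u', v') remain
  to be used. The edge vector is normalised to i.\<close>

lemma cyl_vec_vertical:
  fixes a b x u v u' v' r \<epsilon> N s :: real and e :: complex
  defines "S \<equiv> sin a * cos b" and "D \<equiv> cos a * sin b"
  defines "W \<equiv> D * u - \<epsilon> * r * cos x" and "W' \<equiv> D * u' - \<epsilon> * r * cos x"
  defines "V \<equiv> cyl_vec a b \<epsilon> v x e" and "V' \<equiv> cyl_vec a b \<epsilon> v' x e"
  assumes r: "r\<^sup>2 = D\<^sup>2 - S\<^sup>2" and "\<epsilon>\<^sup>2 = 1" and uv: "u\<^sup>2 - v\<^sup>2 = 1" and e: "cmod e = 1"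
    and N: "N\<^sup>2 - s\<^sup>2 \<noteq> 0" "s \<noteq> 0"
    and u': "(N\<^sup>2 - s\<^sup>2) * u' = (N\<^sup>2 + s\<^sup>2) * u + 2 * N * s * v"
    and v': "(N\<^sup>2 - s\<^sup>2) * v' = (N\<^sup>2 + s\<^sup>2) * v + 2 * N * s * u"
  shows "(W * W') *\<^sub>R quat_pair \<i> 0 - (N / s) *\<^sub>R (W *\<^sub>R V' - W' *\<^sub>R V)
    = - (V' * quat_pair \<i> 0 * V)"
proof -
  define y where "y = e * of_real \<epsilon> * Complex (S * cos x) (- (D * sin x))"
  have V: "V = quat_pair (\<i> * of_real (D * v)) y" "V' = quat_pair (\<i> * of_real (D * v')) y"
    by (simp_all add: V_def V'_def cyl_vec_def y_def S_def D_def)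
  have u'': "u' = ((N\<^sup>2 + s\<^sup>2) * u + 2 * N * s * v) / (N\<^sup>2 - s\<^sup>2)"
    and v'': "v' = ((N\<^sup>2 + s\<^sup>2) * v + 2 * N * s * u) / (N\<^sup>2 - s\<^sup>2)"
    using N u' v' by (simp_all add: field_simps)
  have "(cmod y)\<^sup>2 = \<epsilon>\<^sup>2 * ((S * cos x)\<^sup>2 + (D * sin x)\<^sup>2)"
    unfolding y_def norm_mult power_mult_distrib by (simp add: e cmod_power2 power_mult_distrib)
  then have y: "(cmod y)\<^sup>2 = D\<^sup>2 - r\<^sup>2 * (cos x)\<^sup>2"
    using \<open>\<epsilon>\<^sup>2 = 1\<close> sin_cos_squared_add[of x] unfolding r by algebra
  have y2: "cnj y * y = of_real ((cmod y)\<^sup>2)"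
    by (metis complex_norm_square mult.commute of_real_power)
  \<comment> \<open>\<open>uu\<close>, \<open>vv\<close> and \<open>uv'\<close> are half-angle forms
    of the hyperbolic addition theorem, with s/N as the tangent of half the step.\<close>
  have uu: "N * (u' - u) = s * (v' + v)"
  proof -
    have "(N\<^sup>2 - s\<^sup>2) * (N * (u' - u) - s * (v' + v)) = 0"
      using u' v' by algebra
    with N show ?thesis by simp
  qed
  have vv: "N * (v' - v) = s * (u' + u)"
  proof -
    have "(N\<^sup>2 - s\<^sup>2) * (N * (v' - v) - s * (u' + u)) = 0"
      using u' v' by algebra
    with N show ?thesis by simp
  qed
  have uv': "s * (u * u' - v * v' + 1) = N * (v' * u - v * u')"
  proof -
    have "(N\<^sup>2 - s\<^sup>2) * (s * (u * u' - v * v' + 1) - N * (v' * u - v * u')) = 0"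
      using u' v' uv by algebra
    with N show ?thesis by simp
  qed
  have 1: "W * W' - (N / s) * (W * (D * v') - W' * (D * v)) = D * v * (D * v') - (cmod y)\<^sup>2"
  proof -
    have "s * (W * W') - N * (W * (D * v') - W' * (D * v)) = s * (D * v * (D * v') - (cmod y)\<^sup>2)"
      using uv' vv \<open>\<epsilon>\<^sup>2 = 1\<close> unfolding y W_def W'_def by algebra
    with N show ?thesis by (simp add: field_simps)
  qed
  have 2: "(N / s) * (W - W') = - (D * v) - D * v'"
  proof -
    have "N * (W - W') = s * (- (D * v) - D * v')"
      using uu unfolding W_def W'_def by algebra
    with N show ?thesis by (simp add: field_simps)
  qed
  have "of_real (W * W') * \<i> - of_real (N / s) * (of_real W * (\<i> * of_real (D * v')) - of_real W' * (\<i> * of_real (D * v)))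
      = - (\<i> * of_real (D * v') * \<i> * (\<i> * of_real (D * v)) - cnj (y * \<i>) * y)"
    using arg_cong[OF 1, of "\<lambda>x. \<i> * of_real x"] y2 by (simp add: algebra_simps)
  moreover have "of_real (W * W') * 0 - of_real (N / s) * (of_real W * y - of_real W' * y)
      = - (y * \<i> * (\<i> * of_real (D * v)) + cnj (\<i> * of_real (D * v') * \<i>) * y)"
    using arg_cong[OF 2, of "\<lambda>x. of_real x * y"] by (simp add: algebra_simps diff_divide_distrib)
  ultimately show ?thesis
    unfolding V quat_pair_algebra by (simp add: quat_eq_iff)
qed

text \<open>Returns from numerators V to T = -(c/W) V. With c = 1/s, the values h = 1 and h = -1
  give the coefficients s^2 and -s^2 of horizontal and vertical edges.\<close>

lemma edge_rescale:
  fixes d V V' :: quat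
  assumes eq: "(W * W') *\<^sub>R d - c *\<^sub>R (W *\<^sub>R V' - W' *\<^sub>R V) = h *\<^sub>R (V' * d * V)"
    and nz: "W \<noteq> 0" "W' \<noteq> 0" "c \<noteq> 0"
  shows "d + (- (c / W')) *\<^sub>R V' - (- (c / W)) *\<^sub>R V
    = (h / c\<^sup>2) *\<^sub>R ((- (c / W')) *\<^sub>R V' * d * (- (c / W)) *\<^sub>R V)"
proof -
  have "(h / c\<^sup>2) *\<^sub>R ((- (c / W')) *\<^sub>R V' * d * (- (c / W)) *\<^sub>R V)
      = (1 / (W * W')) *\<^sub>R (h *\<^sub>R (V' * d * V))"
    using nz by (simp add: power2_eq_square field_simps)
  also have "\<dots> = d + (- (c / W')) *\<^sub>R V' - (- (c / W)) *\<^sub>R V"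
    unfolding eq[symmetric] using nz by (simp add: scaleR_diff_right)
  finally show ?thesis by simp
qed

text \<open>The hypothesis makes \<open>n + (1 / \<nu>) *\<^sub>R inverse T - T\<close> the
  reflection of \<open>n\<close> in the hyperplane orthogonal to \<open>T\<close>, and reflections
  preserve the norm.\<close>

lemma norm_christoffel_darboux:
  fixes n T :: quat
  assumes "T \<in> Im_quat" "T \<noteq> 0" and n: "2 * (n \<bullet> T) = (norm T)\<^sup>2 + 1 / \<nu>"
  shows "(norm (n + (1 / \<nu>) *\<^sub>R inverse T - T))\<^sup>2 = (norm n)\<^sup>2"
proof -
  define l where "l = 1 + 1 / (\<nu> * (norm T)\<^sup>2)"
  have "n + (1 / \<nu>) *\<^sub>R inverse T - T = n - l *\<^sub>R T"
    by (simp add: inverse_Im[OF assms(1)] l_def algebra_simps)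
  moreover have "l * (norm T)\<^sup>2 = 2 * (n \<bullet> T)"
    using assms(2) unfolding n l_def by (simp add: algebra_simps)
  moreover have "(norm (n - l *\<^sub>R T))\<^sup>2 = (norm n)\<^sup>2 - 2 * l * (n \<bullet> T) + l * (l * (norm T)\<^sup>2)"
    by (simp add: power2_norm_eq_inner inner_diff inner_commute algebra_simps)
  ultimately show ?thesis by (simp only:)
qed

text \<open>The pair \<open>u\<close>, \<open>v\<close> carries the dependence on n, and
  \<open>x\<close>, \<open>e\<close> that on m, so each kind of edge changes only one of the two
  pairs.\<close>

definition cyl_diff :: "real \<Rightarrow> real \<Rightarrow> real \<Rightarrow> real \<Rightarrow> real \<Rightarrow> real \<Rightarrow> real \<Rightarrow> complex \<Rightarrow> quat" where
  "cyl_diff a b r \<epsilon> u v x e = (- (2 * (sin a * cos b) / r / (cos a * sin b * u - \<epsilon> * r * cos x))) *\<^sub>R cyl_vec a b \<epsilon> v x e"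

text \<open>Since \<open>u\<close> may be negative, W has no fixed sign. Its product with the
  conjugate factor does, and that product is also the squared norm of
  \<open>cyl_vec\<close>.\<close>

lemma cyl_denominator:
  fixes D u r x :: real
  assumes "r\<^sup>2 < D\<^sup>2" "u\<^sup>2 \<ge> 1" "\<epsilon>\<^sup>2 = 1"
  shows "(D * u - \<epsilon> * r * cos x) * (D * u + \<epsilon> * r * cos x) > 0"
proof -
  have "(D * u - \<epsilon> * r * cos x) * (D * u + \<epsilon> * r * cos x) = D\<^sup>2 * u\<^sup>2 - r\<^sup>2 * (cos x)\<^sup>2"
    using assms(3) by algebra
  moreover have "D\<^sup>2 * 1 \<le> D\<^sup>2 * u\<^sup>2"
    using assms(2) by (intro mult_left_mono) auto
  moreover have "r\<^sup>2 * (cos x)\<^sup>2 \<le> r\<^sup>2 * 1"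
    by (intro mult_left_mono) (auto simp: abs_square_le_1)
  ultimately show ?thesis using assms(1) by linarith
qed

text \<open>The squared norm contains W as a factor, so |T|^2 keeps a single W in its denominator,
  as does the inner product of T with the normal direction. The complex number \<open>c\<close>
  measures that direction relative to \<open>e\<close>.\<close>

lemma cyl_vec_norm:
  fixes a b x u v r \<epsilon> :: real and e :: complex
  defines "S \<equiv> sin a * cos b" and "D \<equiv> cos a * sin b"
  assumes r: "r\<^sup>2 = D\<^sup>2 - S\<^sup>2" and "\<epsilon>\<^sup>2 = 1" and uv: "u\<^sup>2 - v\<^sup>2 = 1" and e: "cmod e = 1"
  shows "(norm (cyl_vec a b \<epsilon> v x e))\<^sup>2 = (D * u - \<epsilon> * r * cos x) * (D * u + \<epsilon> * r * cos x)"
    and "quat_pair 0 (c * e) \<bullet> cyl_vec a b \<epsilon> v x e = Re c * \<epsilon> * S * cos x + Im c * \<epsilon> * (- D * sin x)"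
proof -
  have "(norm (cyl_vec a b \<epsilon> v x e))\<^sup>2 = (D * v)\<^sup>2 + \<epsilon>\<^sup>2 * ((S * cos x)\<^sup>2 + (D * sin x)\<^sup>2)"
    unfolding cyl_vec_def norm_quat_pair norm_mult power_mult_distrib D_def S_def
    by (simp add: e cmod_power2 power_mult_distrib)
  also have "\<dots> = (D * u - \<epsilon> * r * cos x) * (D * u + \<epsilon> * r * cos x)"
    using uv r \<open>\<epsilon>\<^sup>2 = 1\<close> sin_cos_squared_add[of x] by algebra
  finally show "(norm (cyl_vec a b \<epsilon> v x e))\<^sup>2 = (D * u - \<epsilon> * r * cos x) * (D * u + \<epsilon> * r * cos x)" .
  have e2: "Re e * Re e + Im e * Im e = 1"
    using e by (metis cmod_power2 power2_eq_square power_one)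
  show "quat_pair 0 (c * e) \<bullet> cyl_vec a b \<epsilon> v x e = Re c * \<epsilon> * S * cos x + Im c * \<epsilon> * (- D * sin x)"
    unfolding cyl_vec_def inner_quat_def S_def D_def
    using e2 by simp algebra
qed

text \<open>Only the quadratic expressions |A|^2, |B|^2 and A times the conjugate of B enter the
  surface; hence the double angle \<open>2 * y\<close>, and hence the factor \<open>S + D\<close>
  common to all three.\<close>

lemma
  fixes a b x y c r \<epsilon> :: real
  defines "S \<equiv> sin a * cos b" and "D \<equiv> cos a * sin b"
  defines "A \<equiv> cis y + cis (- y) * of_real c"
    and "B \<equiv> cis y * of_real (sin (a + b)) + cis (- y) * of_real (sin (a - b) * c)"
  assumes r: "r\<^sup>2 = D\<^sup>2 - S\<^sup>2" "r \<noteq> 0" and "\<epsilon>\<^sup>2 = 1" and c: "c = \<epsilon> * (S + D) / r"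
  shows norm_A: "(cmod A)\<^sup>2 * (2 * r\<^sup>2) = 4 * (S + D) * (D + \<epsilon> * r * cos (2 * y))"
    and norm_B: "2 * (cmod B)\<^sup>2 = 4 * (S + D) * (D - \<epsilon> * r * cos (2 * y))"
    and A_cnj_B: "A * cnj B = of_real (2 * (S + D) / r * \<epsilon>) * Complex (S * cos (2 * y)) (- (D * sin (2 * y)))"
proof -
  have sp: "sin (a + b) = S + D" and sm: "sin (a - b) = S - D"
    by (simp_all add: sin_add sin_diff S_def D_def)
  have sc: "(sin y)\<^sup>2 + (cos y)\<^sup>2 = 1" by simp
  \<comment> \<open>Both relations rest on r^2 = (D - S)(D + S); they eliminate \<open>c\<close>
    from the norms.\<close>
  have c2: "r * c = \<epsilon> * (S + D)" "c\<^sup>2 * (S - D) = - (S + D)"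
  proof -
    show 1: "r * c = \<epsilon> * (S + D)" using r(2) by (simp add: c)
    have "r\<^sup>2 * (c\<^sup>2 * (S - D) + (S + D)) = 0"
      using 1 r(1) \<open>\<epsilon>\<^sup>2 = 1\<close> by algebra
    then show "c\<^sup>2 * (S - D) = - (S + D)" using r(2) by simp
  qed
  have "(cmod A)\<^sup>2 = (cos y * (1 + c))\<^sup>2 + (sin y * (1 - c))\<^sup>2"
    unfolding A_def by (simp add: cmod_power2 algebra_simps)
  then show "(cmod A)\<^sup>2 * (2 * r\<^sup>2) = 4 * (S + D) * (D + \<epsilon> * r * cos (2 * y))"
    using c2 sc r(1) unfolding cos_double by algebra
  have "(cmod B)\<^sup>2 = (cos y * (S + D + (S - D) * c))\<^sup>2 + (sin y * (S + D - (S - D) * c))\<^sup>2"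
    unfolding B_def sp sm by (simp add: cmod_power2 algebra_simps)
  then have "r\<^sup>2 * (2 * (cmod B)\<^sup>2 - 4 * (S + D) * (D - \<epsilon> * r * cos (2 * y))) = 0"
    using c2 sc r(1) unfolding cos_double by algebra
  then show "2 * (cmod B)\<^sup>2 = 4 * (S + D) * (D - \<epsilon> * r * cos (2 * y))"
    using r(2) by simp
  have k: "2 * (S + D) / r * \<epsilon> = 2 * c" by (simp add: c)
  show "A * cnj B = of_real (2 * (S + D) / r * \<epsilon>) * Complex (S * cos (2 * y)) (- (D * sin (2 * y)))"
    (is "?l = ?r")
  proof -
    have "Re ?l = Re ?r"
      unfolding k A_def B_def sp sm using c2(2) sc by (simp add: cos_double) algebra
    moreover have "Im ?l = Im ?r"
      unfolding k A_def B_def sp sm using sin_double[of y] by (simp add: algebra_simps)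
    ultimately show ?thesis by (simp add: complex_eq_iff)
  qed
qed

section \<open>The difference of the two surfaces on single edges\<close>

lemma
  fixes a b r \<epsilon> u v :: real
  assumes r: "r\<^sup>2 = (cos a * sin b)\<^sup>2 - (sin a * cos b)\<^sup>2" and "r \<noteq> 0" "sin a * cos b \<noteq> 0" "\<epsilon>\<^sup>2 = 1"
    and uv: "u\<^sup>2 - v\<^sup>2 = 1"
  shows cyl_diff_horizontal: "cmod \<eta> = 1 \<Longrightarrow>
      quat_pair 0 (\<eta> * (cis a - cis (- a))) + cyl_diff a b r \<epsilon> u v (\<phi> + b) (\<eta> * cis a)
        - cyl_diff a b r \<epsilon> u v (\<phi> - b) (\<eta> * cis (- a))
      = (r / (2 * (sin a * cos b)))\<^sup>2 *\<^sub>R (cyl_diff a b r \<epsilon> u v (\<phi> + b) (\<eta> * cis a)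
        * quat_pair 0 (\<eta> * (cis a - cis (- a))) * cyl_diff a b r \<epsilon> u v (\<phi> - b) (\<eta> * cis (- a)))"
    and cyl_diff_vertical: "\<lbrakk>s = r / (2 * (sin a * cos b)); cmod e = 1; N \<noteq> 0; N\<^sup>2 - s\<^sup>2 \<noteq> 0; u'\<^sup>2 - v'\<^sup>2 = 1;
        (N\<^sup>2 - s\<^sup>2) * u' = (N\<^sup>2 + s\<^sup>2) * u + 2 * N * s * v;
        (N\<^sup>2 - s\<^sup>2) * v' = (N\<^sup>2 + s\<^sup>2) * v + 2 * N * s * u\<rbrakk> \<Longrightarrow>
      quat_pair (\<i> * of_real (1 / N)) 0 + cyl_diff a b r \<epsilon> u' v' x e - cyl_diff a b r \<epsilon> u v x e
      = (- (s\<^sup>2)) *\<^sub>R (cyl_diff a b r \<epsilon> u' v' x e * quat_pair (\<i> * of_real (1 / N)) 0 * cyl_diff a b r \<epsilon> u v x e)"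
    and cyl_diff_nonzero: "cmod e = 1 \<Longrightarrow> cyl_diff a b r \<epsilon> u v x e \<noteq> 0"
    and cyl_diff_in_Im: "cyl_diff a b r \<epsilon> u v x e \<in> Im_quat"
    and cyl_diff_norm: "\<lbrakk>s = r / (2 * (sin a * cos b)); cmod e = 1\<rbrakk> \<Longrightarrow>
      2 * (quat_pair 0 (- 2 * e) \<bullet> cyl_diff a b r \<epsilon> u v x e) = (norm (cyl_diff a b r \<epsilon> u v x e))\<^sup>2 + 1 / (- (s\<^sup>2))"
proof -
  define S D where "S = sin a * cos b" and "D = cos a * sin b"
  define W where "W = (\<lambda>u x. D * u - \<epsilon> * r * cos x)"
  have rSD: "r\<^sup>2 = D\<^sup>2 - S\<^sup>2" using r by (simp add: S_def D_def)
  have S0: "S \<noteq> 0" using assms(3) by (simp add: S_def)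
  have W0: "W u x \<noteq> 0" "D * u + \<epsilon> * r * cos x \<noteq> 0" if "u\<^sup>2 - v\<^sup>2 = 1" for u v x
  proof -
    have "r\<^sup>2 < D\<^sup>2" using S0 rSD by simp
    moreover have "1 \<le> u\<^sup>2" using that by (simp add: algebra_simps)
    ultimately have "0 < W u x * (D * u + \<epsilon> * r * cos x)"
      unfolding W_def using \<open>\<epsilon>\<^sup>2 = 1\<close> by (rule cyl_denominator)
    then show "W u x \<noteq> 0" "D * u + \<epsilon> * r * cos x \<noteq> 0" by auto
  qed
  have c0: "2 * S / r \<noteq> 0" using S0 \<open>r \<noteq> 0\<close> by simp
  have T: "cyl_diff a b r \<epsilon> u v x e = (- (2 * S / r / W u x)) *\<^sub>R cyl_vec a b \<epsilon> v x e" for u v x e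
    by (simp add: cyl_diff_def S_def W_def D_def)
  show "quat_pair 0 (\<eta> * (cis a - cis (- a))) + cyl_diff a b r \<epsilon> u v (\<phi> + b) (\<eta> * cis a)
        - cyl_diff a b r \<epsilon> u v (\<phi> - b) (\<eta> * cis (- a))
      = (r / (2 * (sin a * cos b)))\<^sup>2 *\<^sub>R (cyl_diff a b r \<epsilon> u v (\<phi> + b) (\<eta> * cis a)
        * quat_pair 0 (\<eta> * (cis a - cis (- a))) * cyl_diff a b r \<epsilon> u v (\<phi> - b) (\<eta> * cis (- a)))"
    if "cmod \<eta> = 1"
  proof -
    have "(W u (\<phi> - b) * W u (\<phi> + b)) *\<^sub>R quat_pair 0 (\<eta> * (cis a - cis (- a)))
      - (2 * S / r) *\<^sub>R (W u (\<phi> - b) *\<^sub>R cyl_vec a b \<epsilon> v (\<phi> + b) (\<eta> * cis a)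
          - W u (\<phi> + b) *\<^sub>R cyl_vec a b \<epsilon> v (\<phi> - b) (\<eta> * cis (- a)))
      = 1 *\<^sub>R (cyl_vec a b \<epsilon> v (\<phi> + b) (\<eta> * cis a) * quat_pair 0 (\<eta> * (cis a - cis (- a)))
          * cyl_vec a b \<epsilon> v (\<phi> - b) (\<eta> * cis (- a)))"
      unfolding S_def W_def D_def scaleR_one by (rule cyl_vec_horizontal[OF r \<open>r \<noteq> 0\<close> \<open>\<epsilon>\<^sup>2 = 1\<close> uv that])
    from edge_rescale[OF this W0(1)[OF uv] W0(1)[OF uv] c0] show ?thesis
      unfolding T[symmetric] by (simp add: power_divide S_def)
  qed
  show "quat_pair (\<i> * of_real (1 / N)) 0 + cyl_diff a b r \<epsilon> u' v' x e - cyl_diff a b r \<epsilon> u v x e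
      = (- (s\<^sup>2)) *\<^sub>R (cyl_diff a b r \<epsilon> u' v' x e * quat_pair (\<i> * of_real (1 / N)) 0 * cyl_diff a b r \<epsilon> u v x e)"
    if s: "s = r / (2 * (sin a * cos b))" and e: "cmod e = 1" and N: "N \<noteq> 0" "N\<^sup>2 - s\<^sup>2 \<noteq> 0"
      and uv': "u'\<^sup>2 - v'\<^sup>2 = 1"
      and u': "(N\<^sup>2 - s\<^sup>2) * u' = (N\<^sup>2 + s\<^sup>2) * u + 2 * N * s * v"
      and v': "(N\<^sup>2 - s\<^sup>2) * v' = (N\<^sup>2 + s\<^sup>2) * v + 2 * N * s * u"
  proof -
    have s0: "s \<noteq> 0" "2 * S / r = 1 / s" using S0 \<open>r \<noteq> 0\<close> by (auto simp: s S_def)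
    \<comment> \<open>The vertical identity was proved for i; dividing by N passes to the true edge
      vector i/N and turns N/s into the required 1/s.\<close>
    have i: "quat_pair \<i> 0 = N *\<^sub>R quat_pair (\<i> * of_real (1 / N)) 0"
      using N by (simp add: quat_pair_algebra)
    have "(W u x * W u' x) *\<^sub>R quat_pair \<i> 0
        - (N / s) *\<^sub>R (W u x *\<^sub>R cyl_vec a b \<epsilon> v' x e - W u' x *\<^sub>R cyl_vec a b \<epsilon> v x e)
      = - (cyl_vec a b \<epsilon> v' x e * quat_pair \<i> 0 * cyl_vec a b \<epsilon> v x e)"
      unfolding W_def D_def by (rule cyl_vec_vertical[OF r \<open>\<epsilon>\<^sup>2 = 1\<close> uv e N(2) s0(1) u' v'])
    from arg_cong[OF this, of "\<lambda>q. (1 / N) *\<^sub>R q"]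
    have "(W u x * W u' x) *\<^sub>R quat_pair (\<i> * of_real (1 / N)) 0
      - (2 * S / r) *\<^sub>R (W u x *\<^sub>R cyl_vec a b \<epsilon> v' x e - W u' x *\<^sub>R cyl_vec a b \<epsilon> v x e)
      = (- 1) *\<^sub>R (cyl_vec a b \<epsilon> v' x e * quat_pair (\<i> * of_real (1 / N)) 0 * cyl_vec a b \<epsilon> v x e)"
      unfolding i using N by (simp add: scaleR_diff_right s0(2))
    from edge_rescale[OF this W0(1)[OF uv] W0(1)[OF uv'] c0] show ?thesis
      unfolding T[symmetric] by (simp add: power_divide S_def s)
  qed
  have n2: "(norm (cyl_vec a b \<epsilon> v x e))\<^sup>2 = W u x * (D * u + \<epsilon> * r * cos x)" if "cmod e = 1" for e x
    unfolding W_def D_def by (rule cyl_vec_norm[OF r \<open>\<epsilon>\<^sup>2 = 1\<close> uv that])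
  show "cyl_diff a b r \<epsilon> u v x e \<noteq> 0" if "cmod e = 1"
    unfolding T using n2[OF that, of x] W0[OF uv, of x] c0 by auto
  show "cyl_diff a b r \<epsilon> u v x e \<in> Im_quat"
    unfolding cyl_diff_def cyl_vec_def by (simp add: Im_quat_iff)
  show "2 * (quat_pair 0 (- 2 * e) \<bullet> cyl_diff a b r \<epsilon> u v x e) = (norm (cyl_diff a b r \<epsilon> u v x e))\<^sup>2 + 1 / (- (s\<^sup>2))"
    if s: "s = r / (2 * (sin a * cos b))" and e: "cmod e = 1"
  proof -
    have "(norm (cyl_diff a b r \<epsilon> u v x e))\<^sup>2 = (2 * S / r / W u x)\<^sup>2 * (W u x * (D * u + \<epsilon> * r * cos x))"
      unfolding T norm_scaleR power_mult_distrib n2[OF e] by (simp only: abs_minus_cancel power2_abs)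
    also have "\<dots> = (2 * S / r)\<^sup>2 * (D * u + \<epsilon> * r * cos x) / W u x"
      using W0[OF uv, of x] by (simp add: power2_eq_square)
    \<comment> \<open>The conjugate factor differs from W by
      \<open>2 * \<epsilon> * r * cos x\<close>. Division by W therefore leaves the constant
      (2S/r)^2, which is exactly what 1/\<nu> removes.\<close>
    moreover have frac: "t * (W u x + t') / W u x + - t = t * t' / W u x" for t t'
      using W0[OF uv, of x] by (simp add: field_simps)
    moreover have "1 / (- (s\<^sup>2)) = - ((2 * S / r)\<^sup>2)"
      by (simp add: s S_def power_divide)
    moreover have "D * u + \<epsilon> * r * cos x = W u x + 2 * \<epsilon> * r * cos x"
      by (simp add: W_def)
    ultimately have "(norm (cyl_diff a b r \<epsilon> u v x e))\<^sup>2 + 1 / (- (s\<^sup>2)) = (2 * S / r)\<^sup>2 * (2 * \<epsilon> * r * cos x) / W u x"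
      using frac[of "(2 * S / r)\<^sup>2"] by metis
    moreover have "2 * (quat_pair 0 (- 2 * e) \<bullet> cyl_diff a b r \<epsilon> u v x e)
        = 2 * (- (2 * S / r / W u x) * (- 2 * \<epsilon> * S * cos x))"
      unfolding T inner_scaleR_right cyl_vec_norm(2)[OF r \<open>\<epsilon>\<^sup>2 = 1\<close> uv e] by (simp add: S_def)
    moreover have "2 * (- (2 * S / r / W u x) * (- 2 * \<epsilon> * S * cos x)) = (2 * S / r)\<^sup>2 * (2 * \<epsilon> * r * cos x) / W u x"
      using W0[OF uv, of x] \<open>r \<noteq> 0\<close> by (simp add: field_simps power2_eq_square)
    ultimately show ?thesis by (simp only:)
  qed
qed

section \<open>The transformed cylinder on the whole lattice\<close>

lemma
  fixes a b r \<epsilon> s N :: real and u v :: "int \<Rightarrow> real" and f fhat :: "vertex \<Rightarrow> quat"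
  assumes f: "\<And>m n. f (m, n) = quat_pair (\<i> * of_real (of_int n / N)) (cis (2 * a * of_int m))"
    and \<mu>: "edge_function \<mu>"
      "\<And>m n. 1 / \<mu> (m, n) (m + 1, n) = (cmod (1 - cis (2 * a)))\<^sup>2"
      "\<And>m n. 1 / \<mu> (m, n) (m, n + 1) = - (1 / N\<^sup>2)"
    and fhat: "\<And>m n. fhat (m, n) = f (m, n)
      + cyl_diff a b r \<epsilon> (u n) (v n) (2 * (b * of_int m)) (cis (2 * a * of_int m))"
    and r: "r\<^sup>2 = (cos a * sin b)\<^sup>2 - (sin a * cos b)\<^sup>2" "r \<noteq> 0" "sin a * cos b \<noteq> 0" and \<epsilon>: "\<epsilon>\<^sup>2 = 1"
    and s: "s = r / (2 * (sin a * cos b))" and N: "N \<noteq> 0" "N\<^sup>2 - s\<^sup>2 \<noteq> 0"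
    and uv: "\<And>n. (u n)\<^sup>2 - (v n)\<^sup>2 = 1"
    and u_step: "\<And>n. (N\<^sup>2 - s\<^sup>2) * u (n + 1) = (N\<^sup>2 + s\<^sup>2) * u n + 2 * N * s * v n"
    and v_step: "\<And>n. (N\<^sup>2 - s\<^sup>2) * v (n + 1) = (N\<^sup>2 + s\<^sup>2) * v n + 2 * N * s * u n"
  shows cylinder_darboux: "darboux_transform \<mu> (- (s\<^sup>2)) f fhat"
    and cylinder_darboux_in_Im: "range fhat \<subseteq> Im_quat"
    and cylinder_darboux_cmc: "discrete_cmc (1 / 2) fhat"
proof -
  define T where "T = (\<lambda>p. fhat p - f p)"
  have T: "T (m, n) = cyl_diff a b r \<epsilon> (u n) (v n) (2 * (b * of_int m)) (cis (2 * a * of_int m))" for m n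
    by (simp add: T_def fhat)
  have T0: "T p \<noteq> 0" for p
    by (cases p) (simp add: T cyl_diff_nonzero[OF r \<epsilon> uv])
  have TIm: "T p \<in> Im_quat" for p
    by (cases p) (simp add: T cyl_diff_in_Im[OF r \<epsilon> uv])
  have fIm: "f p \<in> Im_quat" for p
    by (cases p) (simp add: f quat_pair_in_Im)
  have gf: "fhat p = f p + T p" for p by (simp add: T_def)
  have gIm: "fhat p \<in> Im_quat" for p
    using fIm[of p] TIm[of p] by (simp add: gf Im_quat_iff)
  show rg: "range fhat \<subseteq> Im_quat" using gIm by blast
  have rf: "range f \<subseteq> Im_quat" using fIm by blast
  have s0: "s \<noteq> 0" using r s by auto
  have iso: "discrete_isothermic \<mu> f"
    by (rule circular_cylinder_isothermic[OF f \<mu> N(1)])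
  have chr: "christoffel_transform \<mu> f
      (\<lambda>(m, n). quat_pair (\<i> * of_real (of_int n / N)) (- cis (2 * a * of_int m)))" (is "christoffel_transform _ _ ?h")
    by (rule circular_cylinder_christoffel[OF f \<mu> N(1)])
  have gne: "fhat p \<noteq> f p" for p
    using T0[of p] by (simp add: gf)
  \<comment> \<open>For imaginary d the inverse is a negative multiple of d, so (\<nu>/\<mu>) d^-1
    becomes h d, with h = s^2 on horizontal and h = -s^2 on vertical edges.\<close>
  have edge: "cross_ratio (f p) (f q) (fhat q) (fhat p) = of_real \<kappa>"
    if "f q - f p = d" "d \<noteq> 0" "\<kappa> *\<^sub>R inverse d = h *\<^sub>R d" "d + T q - T p = h *\<^sub>R (T q * d * T p)"
    for p q d h \<kappa>
  proof -
    have ne: "f p \<noteq> f q" "f q \<noteq> fhat q" "fhat p \<noteq> f p"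
      using that(1,2) gne[of p] gne[of q] by auto
    have "fhat q - fhat p = d + T q - T p"
      using that(1) by (simp add: gf algebra_simps)
    also have "\<dots> = T q * (h *\<^sub>R d) * T p"
      unfolding that(4) by simp
    also have "\<dots> = \<kappa> *\<^sub>R (T q * inverse d * T p)"
      unfolding that(3)[symmetric] by simp
    finally show ?thesis
      unfolding cross_ratio_edge_iff[OF ne] using that(1) by (simp add: T_def)
  qed
  show dar: "darboux_transform \<mu> (- (s\<^sup>2)) f fhat"
    unfolding darboux_transform_def
  proof (intro conjI allI impI iso gne)
    fix p q assume "adjacent p q"
    then show "cross_ratio (f p) (f q) (fhat q) (fhat p) = of_real (- (s\<^sup>2) / \<mu> p q)"
    proof (induction rule: edge_induct)
      case (horizontal m n)
      \<comment> \<open>The midpoint of the edge: the angle halfway between those at m and m +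
        1.\<close>
      define \<eta> where "\<eta> = cis (a * (2 * of_int m + 1))"
      define d where "d = quat_pair 0 (\<eta> * (cis a - cis (- a)))"
      have \<eta>: "cmod \<eta> = 1" "\<eta> * cis a = cis (2 * a * of_int (m + 1))" "\<eta> * cis (- a) = cis (2 * a * of_int m)"
        by (simp_all add: \<eta>_def cis_mult algebra_simps)
      have ph: "b * (2 * of_int m + 1) + b = 2 * (b * of_int (m + 1))"
        "b * (2 * of_int m + 1) - b = 2 * (b * of_int m)"
        by (simp_all add: algebra_simps)
      have "d + T (m + 1, n) - T (m, n) = s\<^sup>2 *\<^sub>R (T (m + 1, n) * d * T (m, n))"
        using cyl_diff_horizontal[OF r \<epsilon> uv \<eta>(1), of n "b * (2 * of_int m + 1)"]
        unfolding ph \<eta>(2,3) T s d_def right_diff_distrib .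
      moreover have "f (m + 1, n) - f (m, n) = d"
        unfolding f d_def quat_pair_algebra right_diff_distrib \<eta>(2,3) by simp
      moreover have "cis a - cis (- a) \<noteq> 0"
        using r(3) by (simp add: complex_eq_iff)
      then have "d \<noteq> 0"
        using \<eta>(1) by (auto simp: d_def quat_pair_eq_0_iff)
      moreover have "(- (s\<^sup>2) / \<mu> (m, n) (m + 1, n)) *\<^sub>R inverse d = s\<^sup>2 *\<^sub>R d"
      proof -
        have "(norm d)\<^sup>2 = (cmod (1 - cis (2 * a)))\<^sup>2"
          using norm_cis_diff[of "2 * a * of_int m" "2 * a"]
          unfolding d_def norm_quat_pair right_diff_distrib \<eta>(2,3) by (simp add: algebra_simps)
        then have i: "inverse d = - ((1 / (cmod (1 - cis (2 * a)))\<^sup>2) *\<^sub>R d)" "cmod (1 - cis (2 * a)) \<noteq> 0"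
          using inverse_Im[of d] \<open>d \<noteq> 0\<close> by (auto simp: d_def quat_pair_in_Im)
        have "- (s\<^sup>2) / \<mu> (m, n) (m + 1, n) = - (s\<^sup>2) * (cmod (1 - cis (2 * a)))\<^sup>2"
          unfolding \<mu>(2)[of m n, symmetric] by simp
        then show ?thesis using i by simp
      qed
      ultimately show ?case using edge by blast
    next
      case (vertical m n)
      define d where "d = quat_pair (\<i> * of_real (1 / N)) 0"
      have "d + T (m, n + 1) - T (m, n) = (- (s\<^sup>2)) *\<^sub>R (T (m, n + 1) * d * T (m, n))"
        unfolding T d_def
        by (rule cyl_diff_vertical[OF r \<epsilon> uv s norm_cis N uv u_step v_step])
      moreover have "f (m, n + 1) - f (m, n) = d"
        unfolding f d_def quat_pair_algebra by (simp add: quat_eq_iff add_divide_distrib)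
      moreover have "d \<noteq> 0"
        using N(1) by (simp add: d_def quat_eq_iff)
      moreover have "(- (s\<^sup>2) / \<mu> (m, n) (m, n + 1)) *\<^sub>R inverse d = (- (s\<^sup>2)) *\<^sub>R d"
      proof -
        have "- (s\<^sup>2) / \<mu> (m, n) (m, n + 1) = - (s\<^sup>2) * (1 / \<mu> (m, n) (m, n + 1))" by simp
        also have "\<dots> = s\<^sup>2 / N\<^sup>2" unfolding \<mu>(3) by simp
        finally show ?thesis
          using N(1) by (simp add: d_def inverse_quat_pair_Im norm_divide power_divide quat_eq_iff)
      qed
      ultimately show ?case using edge by blast
    next
      case (swap p q)
      have "- (s\<^sup>2) / \<mu> p q \<noteq> 0"
        using s0 discrete_isothermic_edge(2)[OF iso swap(1)] by simp
      then show ?case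
        using cross_ratio_swap_Im[OF fIm fIm gIm gIm swap(2)] discrete_isothermic_edge(1)[OF iso swap(1)]
        by simp
    qed
  qed
  have nu: "- (s\<^sup>2) \<noteq> 0" using s0 by simp
  show "discrete_cmc (1 / 2) fhat"
    unfolding discrete_cmc_def
  proof (intro conjI rg exI allI)
    let ?g = "\<lambda>p. ?h p + (1 / (- (s\<^sup>2))) *\<^sub>R inverse (fhat p - f p)"
    show "christoffel_transform \<mu> fhat ?g"
      by (rule darboux_christoffel[OF dar nu rf rg chr])
    have "?h p \<in> Im_quat" for p
      by (cases p) (simp add: quat_pair_in_Im)
    then have "?g p \<in> Im_quat" for p
      using inverse_Im_in_Im[OF TIm[of p]] unfolding T_def Im_quat_iff by simp
    then show "range ?g \<subseteq> Im_quat" by blast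
    fix p :: vertex
    obtain m n where p: "p = (m, n)" by (metis surj_pair)
    define e where "e = cis (2 * a * of_int m)"
    \<comment> \<open>The dual cylinder is the antipode of \<open>f\<close> on the same unit circle.
      The distance 2 is the source of H = 1/2.\<close>
    have n: "?h p - f p = quat_pair 0 (- 2 * e)"
      by (simp add: p f quat_pair_algebra e_def)
    have "?g p - fhat p = (?h p - f p) + (1 / (- (s\<^sup>2))) *\<^sub>R inverse (T p) - T p"
      by (simp add: T_def)
    also have "(norm \<dots>)\<^sup>2 = (norm (?h p - f p))\<^sup>2"
    proof (rule norm_christoffel_darboux[OF TIm T0])
      show "2 * ((?h p - f p) \<bullet> T p) = (norm (T p))\<^sup>2 + 1 / (- (s\<^sup>2))"
        unfolding n unfolding p T e_def by (rule cyl_diff_norm[OF r \<epsilon> uv s norm_cis])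
    qed
    also have "\<dots> = 1 / (1 / 2)\<^sup>2"
      unfolding n norm_quat_pair by (simp add: e_def norm_mult power2_eq_square)
    finally show "(norm (?g p - fhat p))\<^sup>2 = 1 / (1 / 2)\<^sup>2" .
  qed simp
qed

section \<open>The closed formula and its period\<close>

theorem mainTheorem7:
  fixes M N \<rho> k :: int
    and \<nu> c\<^sub>2 :: real
    and \<mu> :: "vertex \<Rightarrow> vertex \<Rightarrow> real"
    and A B :: "int \<Rightarrow> complex"
    and C :: "int \<Rightarrow> int \<Rightarrow> real"
    and T\<^sub>0 T\<^sub>1 :: "int \<Rightarrow> int \<Rightarrow> complex"
    and f fhat :: "vertex \<Rightarrow> quat"
  assumes "M > 2" and "N \<noteq> 0" and "\<rho> > 0" and "k > \<rho>"
    and "of_int k / of_int (\<rho> * M) < (1 / 2 :: real)"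
    and "\<nu> = 1 / 4 * (1 - (cot (pi / of_int M))\<^sup>2 * (tan (of_int k * pi / of_int (\<rho> * M)))\<^sup>2)"
    and "\<nu> \<noteq> - (of_int N)\<^sup>2"
    and "\<And>m n. f (m, n) = quat_of_complex (\<i> * of_real (of_int n / of_int N))
                       + quat_j * quat_of_complex (cis (2 * pi / of_int M * of_int m))"
    and "edge_function \<mu>"
    and "\<And>m n. 1 / \<mu> (m, n) (m + 1, n) = (cmod (1 - cis (2 * pi / of_int M)))\<^sup>2"
    and "\<And>m n. 1 / \<mu> (m, n) (m, n + 1) = - (1 / (of_int N)\<^sup>2)"
    and "c\<^sub>2 = sqrt (cos (2 * pi / of_int M) - cos (2 * of_int k * pi / of_int (\<rho> * M)))
               / (sqrt 2 * sin (of_int (\<rho> - k) * pi / of_int (\<rho> * M)))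
       \<or> c\<^sub>2 = - (sqrt (cos (2 * pi / of_int M) - cos (2 * of_int k * pi / of_int (\<rho> * M)))
               / (sqrt 2 * sin (of_int (\<rho> - k) * pi / of_int (\<rho> * M))))"
    and "\<And>m. A m = cis (of_int k * pi / of_int (\<rho> * M) * of_int m) + cis (- (of_int k * pi / of_int (\<rho> * M)) * of_int m) * of_real c\<^sub>2"
    and "\<And>m. B m = cis (of_int k * pi / of_int (\<rho> * M) * of_int m) * of_real (sin (of_int (\<rho> + k) * pi / of_int (\<rho> * M)))
                 + cis (- (of_int k * pi / of_int (\<rho> * M)) * of_int m)
                     * of_real (sin (of_int (\<rho> - k) * pi / of_int (\<rho> * M)) * c\<^sub>2)"
    and "\<And>m n. C m n =
          2 * ((of_int N - sqrt (- \<nu>)) powi n + (of_int N + sqrt (- \<nu>)) powi n)\<^sup>2 * (cmod (B m))\<^sup>2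
          + ((of_int N - sqrt (- \<nu>)) powi n - (of_int N + sqrt (- \<nu>)) powi n)\<^sup>2 * (cmod (A m))\<^sup>2
            * (cos (2 * pi / of_int M) - cos (2 * of_int k * pi / of_int (\<rho> * M)))"
    and "\<And>m n. T\<^sub>0 m n =
          \<i> / of_real (sqrt (- \<nu>))
          * of_real ((of_int N - sqrt (- \<nu>)) powi (2 * n) - (of_int N + sqrt (- \<nu>)) powi (2 * n))
          * of_real (2 * (cmod (B m))\<^sup>2
              + (cmod (A m))\<^sup>2 * (cos (2 * pi / of_int M) - cos (2 * of_int k * pi / of_int (\<rho> * M))))"
    and "\<And>m n. T\<^sub>1 m n =
          - 16 * cis (2 * pi / of_int M * of_int m)
          * of_real ((of_int N - sqrt (- \<nu>)) powi n * (of_int N + sqrt (- \<nu>)) powi n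
              * sin (pi / of_int M) * cos (of_int k * pi / of_int (\<rho> * M)))
          * A m * cnj (B m)"
    and "\<And>m n. fhat (m, n) = f (m, n)
          + (1 / C m n) *\<^sub>R (quat_of_complex (T\<^sub>0 m n) + quat_j * quat_of_complex (T\<^sub>1 m n))"
  shows "\<nu> < 0 \<and>
    darboux_transform \<mu> \<nu> f fhat \<and>
    range fhat \<subseteq> Im_quat \<and>
    (\<exists>H. discrete_cmc H fhat) \<and>
    (\<forall>m n. fhat (m + \<rho> * M, n) = fhat (m, n))"
proof -
  define a b S D where "a = pi / of_int M" and "b = of_int k * pi / of_int (\<rho> * M)"
    and "S = sin a * cos b" and "D = cos a * sin b"
  define r s where "r = sqrt (D\<^sup>2 - S\<^sup>2)" and "s = r / (2 * S)"
  have M: "real_of_int M > 2" and \<rho>: "real_of_int \<rho> > 0" and k: "real_of_int k > of_int \<rho>"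
    using assms(1,3,4) by simp_all
  \<comment> \<open>The integer conditions in terms of angles: k > \<rho> gives a < b, and
    k/(\<rho>M) < 1/2 gives b < pi/2. Then D - S = sin (b - a) > 0, which makes \<open>r\<close>
    real and positive.\<close>
  have ab: "0 < a" "a < b" "b < pi / 2"
  proof -
    show "0 < a" using M by (simp add: a_def)
    have "a = of_int \<rho> * pi / of_int (\<rho> * M)" using \<rho> by (simp add: a_def)
    also have "\<dots> < b"
      unfolding b_def using M \<rho> k by (intro divide_strict_right_mono mult_strict_right_mono) auto
    finally show "a < b" .
    have "b = of_int k / of_int (\<rho> * M) * pi" by (simp add: b_def)
    also have "\<dots> < 1 / 2 * pi" by (rule mult_strict_right_mono[OF assms(5)]) simp
    finally show "b < pi / 2" by simp
  qed
  have pos: "0 < sin a" "0 < cos a" "0 < sin b" "0 < cos b"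
    using ab by (auto intro!: sin_gt_zero cos_gt_zero)
  have SD: "0 < S" "S < D"
  proof -
    show "0 < S" using pos by (simp add: S_def)
    have "0 < sin (b - a)" using ab by (intro sin_gt_zero) auto
    then show "S < D" by (simp add: sin_diff S_def D_def mult.commute)
  qed
  then have "S\<^sup>2 < D\<^sup>2" by (intro power_strict_mono) auto
  then have r: "r\<^sup>2 = D\<^sup>2 - S\<^sup>2" "0 < r" by (auto simp: r_def)
  have s: "0 < s" using r SD by (simp add: s_def)
  have angles: "2 * pi / of_int M = 2 * a" "2 * of_int k * pi / of_int (\<rho> * M) = 2 * b"
    "of_int (\<rho> - k) * pi / of_int (\<rho> * M) = a - b" "of_int (\<rho> + k) * pi / of_int (\<rho> * M) = a + b"
    using M \<rho> by (simp_all add: a_def b_def field_simps)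
  note angles = angles a_def[symmetric] b_def[symmetric]
  \<comment> \<open>The radicand of \<open>c\<^sub>2\<close> and the weight of |A|^2 in
    \<open>C\<close> and \<open>T\<^sub>0\<close>.\<close>
  have \<Delta>: "cos (2 * a) - cos (2 * b) = 2 * r\<^sup>2"
    unfolding r cos_double S_def D_def using sin_cos_squared_add[of a] sin_cos_squared_add[of b] by algebra
  have \<nu>: "\<nu> = - (s\<^sup>2)"
  proof -
    have "(cot a * tan b)\<^sup>2 = (D / S)\<^sup>2"
      by (simp add: cot_def tan_def S_def D_def)
    then show ?thesis
      using SD unfolding assms(6) angles s_def power_divide power_mult_distrib r(1)
      by (simp add: field_simps)
  qed
  have sqrt\<nu>: "sqrt (- \<nu>) = s" using s by (simp add: \<nu>)
  \<comment> \<open>Since S - D is negative, r/(S - D) = -(S + D)/r: the positive sign of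
    \<open>c\<^sub>2\<close> corresponds to \<epsilon> = -1 and the negative one to \<epsilon> =
    1.\<close>
  obtain \<epsilon> where \<epsilon>: "\<epsilon>\<^sup>2 = 1" and c\<^sub>2: "c\<^sub>2 = \<epsilon> * (S + D) / r"
  proof -
    have sm: "sin (a - b) = S - D" by (simp add: sin_diff S_def D_def)
    have "sqrt (2 * r\<^sup>2) / (sqrt 2 * (S - D)) = r / (S - D)"
      using r(2) by (simp add: real_sqrt_mult)
    also have "\<dots> = - ((S + D) / r)"
      using r SD by (simp add: field_simps power2_eq_square)
    also have "\<dots> = - 1 * (S + D) / r" by (metis minus_divide_left mult_minus1)
    finally have "c\<^sub>2 = - 1 * (S + D) / r \<or> c\<^sub>2 = - (- 1 * (S + D) / r)"
      using assms(12) unfolding angles \<Delta> sm by (elim disjE) (simp_all only: simp_thms)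
    moreover have "- (- 1 * (S + D) / r) = 1 * (S + D) / r"
      by (simp only: mult_minus1 divide_minus_left minus_minus mult_1_left)
    ultimately show ?thesis using that[of 1] that[of "- 1"] by (elim disjE) (simp_all only: power_one power2_minus simp_thms)
  qed
  define N' where "N' = real_of_int N"
  have N: "N' \<noteq> 0" "N'\<^sup>2 - s\<^sup>2 \<noteq> 0"
    using assms(2,7) by (auto simp: N'_def \<nu>)
  \<comment> \<open>Here \<nu> \<noteq> -N^2 enters: both bases are nonzero, so the powers behave
    well for negative n too.\<close>
  have N2: "N' - s \<noteq> 0" "N' + s \<noteq> 0"
    using N(2) by (auto simp: power2_eq_square algebra_simps add_eq_0_iff)
  define p q where "p = (\<lambda>n. (N' - s) powi n)" and "q = (\<lambda>n. (N' + s) powi n)"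
  have pq0: "p n \<noteq> 0" "q n \<noteq> 0" for n using N2 by (simp_all add: p_def q_def)
  have pq1: "p (n + 1) = (N' - s) * p n" "q (n + 1) = (N' + s) * q n" for n
    using N2 by (simp_all add: p_def q_def power_int_add)
  have pq2: "(N' - s) powi (2 * n) = (p n)\<^sup>2" "(N' + s) powi (2 * n) = (q n)\<^sup>2" for n
    using N2 by (simp_all only: p_def q_def mult_2 power_int_add power2_eq_square simp_thms)
  define u v where "u = (\<lambda>n. ((p n)\<^sup>2 + (q n)\<^sup>2) / (2 * (p n * q n)))"
    and "v = (\<lambda>n. ((q n)\<^sup>2 - (p n)\<^sup>2) / (2 * (p n * q n)))"
  have u: "(p n)\<^sup>2 + (q n)\<^sup>2 = 2 * (p n * q n) * u n" and v: "(q n)\<^sup>2 - (p n)\<^sup>2 = 2 * (p n * q n) * v n" for n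
    using pq0[of n] by (simp_all add: u_def v_def)
  have uv: "(u n)\<^sup>2 - (v n)\<^sup>2 = 1" for n
  proof -
    have "4 * (p n * q n)\<^sup>2 * ((u n)\<^sup>2 - (v n)\<^sup>2 - 1) = 0"
      using u[of n] v[of n] by algebra
    then show ?thesis using pq0[of n] by simp
  qed
  have step: "(N'\<^sup>2 - s\<^sup>2) * u (n + 1) = (N'\<^sup>2 + s\<^sup>2) * u n + 2 * N' * s * v n"
    "(N'\<^sup>2 - s\<^sup>2) * v (n + 1) = (N'\<^sup>2 + s\<^sup>2) * v n + 2 * N' * s * u n" for n
  proof -
    have "2 * (p n * q n) * ((N'\<^sup>2 - s\<^sup>2) * u (n + 1) - ((N'\<^sup>2 + s\<^sup>2) * u n + 2 * N' * s * v n)) = 0"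
      using u[of n] v[of n] u[of "n + 1"] unfolding pq1 by algebra
    then show "(N'\<^sup>2 - s\<^sup>2) * u (n + 1) = (N'\<^sup>2 + s\<^sup>2) * u n + 2 * N' * s * v n"
      using pq0[of n] by simp
    have "2 * (p n * q n) * ((N'\<^sup>2 - s\<^sup>2) * v (n + 1) - ((N'\<^sup>2 + s\<^sup>2) * v n + 2 * N' * s * u n)) = 0"
      using u[of n] v[of n] v[of "n + 1"] unfolding pq1 by algebra
    then show "(N'\<^sup>2 - s\<^sup>2) * v (n + 1) = (N'\<^sup>2 + s\<^sup>2) * v n + 2 * N' * s * u n"
      using pq0[of n] by simp
  qed
  have f: "f (m, n) = quat_pair (\<i> * of_real (of_int n / N')) (cis (2 * a * of_int m))" for m n
    unfolding assms(8) angles by (simp add: quat_pair_def N'_def)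
  have fhat: "fhat (m, n) = f (m, n)
      + cyl_diff a b r \<epsilon> (u n) (v n) (2 * (b * of_int m)) (cis (2 * a * of_int m))" for m n
  proof -
    define g where "g = \<epsilon> * r * cos (2 * (b * of_int m))"
    define W where "W = D * u n - g"
    have W0: "W \<noteq> 0"
    proof -
      have "1 \<le> (u n)\<^sup>2" using uv[of n] by (simp add: algebra_simps)
      moreover have "r\<^sup>2 < D\<^sup>2" using r SD by simp
      ultimately have "0 < W * (D * u n + g)"
        using \<epsilon> unfolding W_def g_def by (intro cyl_denominator)
      then show ?thesis by auto
    qed
    have Am: "A m = cis (b * of_int m) + cis (- (b * of_int m)) * of_real c\<^sub>2"
      and Bm: "B m = cis (b * of_int m) * of_real (sin (a + b)) + cis (- (b * of_int m)) * of_real (sin (a - b) * c\<^sub>2)"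
      unfolding assms(13,14) angles by simp_all
    note AB = norm_A[of r a b \<epsilon> c\<^sub>2 "b * of_int m"] norm_B[of r a b \<epsilon> c\<^sub>2 "b * of_int m"]
      A_cnj_B[of r a b \<epsilon> c\<^sub>2 "b * of_int m"]
    have nA: "(cmod (A m))\<^sup>2 * (2 * r\<^sup>2) = 4 * (S + D) * (D + g)"
      and nB: "2 * (cmod (B m))\<^sup>2 = 4 * (S + D) * (D - g)"
      and AcB: "A m * cnj (B m) = of_real (2 * (S + D) / r * \<epsilon>)
        * Complex (S * cos (2 * (b * of_int m))) (- (D * sin (2 * (b * of_int m))))"
      using AB r \<epsilon> c\<^sub>2 unfolding Am Bm S_def D_def g_def by simp_all
    \<comment> \<open>By \<open>nA\<close> and \<open>nB\<close> this is (p + q)^2 (D - g) + (p -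
      q)^2 (D + g) = 2D(p^2 + q^2) - 4pqg, up to the factor 4(S + D).\<close>
    have C: "C m n = 16 * (S + D) * (p n * q n) * W"
    proof -
      have "C m n = (p n + q n)\<^sup>2 * (2 * (cmod (B m))\<^sup>2) + (p n - q n)\<^sup>2 * ((cmod (A m))\<^sup>2 * (2 * r\<^sup>2))"
        unfolding assms(15) angles \<Delta> sqrt\<nu> N'_def[symmetric] p_def q_def by simp
      also have "\<dots> = 16 * (S + D) * (p n * q n) * W"
        using u[of n] unfolding nA nB W_def by algebra
      finally show ?thesis .
    qed
    define K where "K = 16 * (S + D) * (p n * q n)"
    have K0: "K \<noteq> 0" using SD pq0[of n] by (auto simp: K_def)
    have s': "1 / s = 2 * S / r" by (simp add: s_def)
    have "T\<^sub>0 m n = of_real (((p n)\<^sup>2 - (q n)\<^sup>2) * (2 * (cmod (B m))\<^sup>2 + (cmod (A m))\<^sup>2 * (2 * r\<^sup>2)) / s) * \<i>"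
      unfolding assms(16) angles \<Delta> sqrt\<nu> N'_def[symmetric] pq2 by simp
    \<comment> \<open>The \<open>g\<close>-terms of \<open>nA\<close> and \<open>nB\<close> cancel
      in the sum, so the axial component depends on m only through W.\<close>
    also have "((p n)\<^sup>2 - (q n)\<^sup>2) * (2 * (cmod (B m))\<^sup>2 + (cmod (A m))\<^sup>2 * (2 * r\<^sup>2)) / s
        = - (K * (D * v n)) * (1 / s)"
      using v[of n] unfolding nA nB K_def by (simp add: divide_inverse) algebra
    finally have T\<^sub>0: "of_real (1 / C m n) * T\<^sub>0 m n = of_real (- (2 * S / r / W)) * (\<i> * of_real (D * v n))"
      unfolding C K_def[symmetric] s' using K0 W0 by (simp add: mult_ac)
    have T\<^sub>1: "T\<^sub>1 m n = - 16 * cis (2 * a * of_int m) * of_real (p n * q n * S) * (A m * cnj (B m))"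
      unfolding assms(17) angles sqrt\<nu> N'_def[symmetric] S_def p_def q_def by (simp add: mult_ac)
    have "T\<^sub>1 m n = of_real (- (2 * K * S / r)) * (cis (2 * a * of_int m) * of_real \<epsilon>
        * Complex (S * cos (2 * (b * of_int m))) (- (D * sin (2 * (b * of_int m)))))"
      unfolding T\<^sub>1 AcB K_def by (simp add: mult_ac)
    then have T\<^sub>1: "of_real (1 / C m n) * T\<^sub>1 m n = of_real (- (2 * S / r / W)) * (cis (2 * a * of_int m) * of_real \<epsilon>
        * Complex (S * cos (2 * (b * of_int m))) (- (D * sin (2 * (b * of_int m)))))"
      unfolding C K_def[symmetric] using K0 W0 by (simp add: mult_ac)
    have "fhat (m, n) = f (m, n) + (1 / C m n) *\<^sub>R quat_pair (T\<^sub>0 m n) (T\<^sub>1 m n)"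
      unfolding assms(18) quat_pair_def ..
    then show ?thesis
      unfolding quat_pair_algebra T\<^sub>0 T\<^sub>1 cyl_diff_def cyl_vec_def S_def D_def W_def g_def .
  qed
  have \<mu>: "1 / \<mu> (m, n) (m + 1, n) = (cmod (1 - cis (2 * a)))\<^sup>2" "1 / \<mu> (m, n) (m, n + 1) = - (1 / N'\<^sup>2)" for m n
    using assms(10,11) unfolding angles N'_def by blast+
  have r': "r\<^sup>2 = (cos a * sin b)\<^sup>2 - (sin a * cos b)\<^sup>2" "r \<noteq> 0" "sin a * cos b \<noteq> 0" "s = r / (2 * (sin a * cos b))"
    using r SD unfolding s_def S_def D_def by auto
  note C = f assms(9) \<mu> fhat r'(1-3) \<epsilon> r'(4) N uv step
  have period: "cis (x + 2 * pi * of_int j) = cis x" for x j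
    by (simp add: cis_mult[symmetric] cis_multiple_2pi)
  have "fhat (m + \<rho> * M, n) = fhat (m, n)" for m n
  proof -
    \<comment> \<open>A and B themselves only return up to the sign (-1)^k; \<open>cyl_diff\<close>
      contains the doubled angle alone and is therefore truly periodic.\<close>
    have "2 * a * of_int (m + \<rho> * M) = 2 * a * of_int m + 2 * pi * of_int \<rho>"
      "2 * (b * of_int (m + \<rho> * M)) = 2 * (b * of_int m) + 2 * pi * of_int k"
      using M \<rho> by (simp_all add: a_def b_def field_simps)
    then have e: "cis (2 * a * of_int (m + \<rho> * M)) = cis (2 * a * of_int m)"
      and x: "cis (2 * (b * of_int (m + \<rho> * M))) = cis (2 * (b * of_int m))"
      by (simp_all only: period)
    have cs: "cos (2 * (b * of_int (m + \<rho> * M))) = cos (2 * (b * of_int m))"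
      "sin (2 * (b * of_int (m + \<rho> * M))) = sin (2 * (b * of_int m))"
      using arg_cong[OF x, of Re] arg_cong[OF x, of Im] by simp_all
    show ?thesis
      unfolding fhat f e cyl_diff_def cyl_vec_def cs ..
  qed
  moreover have "\<nu> < 0" using s by (simp add: \<nu>)
  ultimately show ?thesis
    using cylinder_darboux[of f N' a \<mu> fhat b r \<epsilon> u v s, OF C] cylinder_darboux_in_Im[of f N' a \<mu> fhat b r \<epsilon> u v s, OF C] cylinder_darboux_cmc[of f N' a \<mu> fhat b r \<epsilon> u v s, OF C]
    unfolding \<nu> by blast
qed

end
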